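(* The function $\sigma(\tau,z):=\sigma(z,[\tau,1])$ on $\mathfrak{H}\times\mathbb{C}$ belongs to $J_{-1}(\mathrm{SL}_2(\mathbb{Z}))$.
   Context: $\mathfrak{H}$ is the upper half-plane, $e(x)=\exp(2\pi ix)$, $q=e(\tau)$, $\zeta=e(z)$. $\sigma(z,L)=z\prod_{\omega\in L-\{0\}}(1-z/\omega)e^{z/\omega+(z/\omega)^2/2}$ is the Weierstrass $\sigma$-function of a lattice $L$. For $L=[\omega_1,\omega_2]$, $\eta(\omega,L)$ for $\omega\in L$ is the quasi-period of the Weierstrass $\zeta$-function ($\zeta(z+\omega,L)=\zeta(z,L)+\eta(\omega,L)$), extended $\mathbb{R}$-linearly. $\psi(z,L)=-1$ if $z\in L-2L$, $1$ otherwise; $\psi(\lambda\ \mu):=\psi(\lambda\tau+\mu,[\tau,1])$. For integer $k$: $(\phi|'_kM)(\tau,z)=(c\tau+d)^{-k}\phi(\frac{a\tau+b}{c\tau+d},\frac{z}{c\tau+d})$ for $M=\begin{pmatrix}a&b\\c&d\end{pmatrix}$, and $(\phi|''_k[\lambda\ \mu])(\tau,z)=\big(\psi(\lambda\ \mu)\exp(\eta(\lambda\tau+\mu,[\tau,1])(z+\tfrac12(\lambda\tau+\mu)))\big)^k\phi(\tau,z+\lambda\tau+\mu)$. $\rho(\tau,z)=\exp(\tfrac12\eta(1,[\tau,1])z^2-\pi iz)$. For a finite-index $\Gamma\subset\mathrm{SL}_2(\mathbb{Z})$, $J_k(\Gamma)$ is the space of holomorphic $\phi:\mathfrak{H}\times\mathbb{C}\to\mathbb{C}$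 with (i) $\phi|'_kM=\phi$ for $M\in\Gamma$; (ii) $\phi|''_kX=\phi$ for $X\in\mathbb{Z}^2$; (iii) for each $M\in\mathrm{SL}_2(\mathbb{Z})$, $\rho^k(\phi|'_kM)=\sum_{n\ge0}\sum_{|r|\le r_0(n)}c(n,r)q^n\zeta^r$ for some increasing sequence of nonnegative integers $r_0(n)$ with $r_0(n)/n\to0$. *)

theory Defs
  imports "HOL-Analysis.Analysis"
begin

definition upper_half_plane :: "complex set" where
  "upper_half_plane = {\<tau>. Im \<tau> > 0}"

definition unit_exp :: "complex \<Rightarrow> complex" where
  "unit_exp x = exp (2 * of_real pi * \<i> * x)"

definition period_lattice :: "complex \<Rightarrow> complex \<Rightarrow> complex set" where
  "period_lattice \<omega>1 \<omega>2 = {of_int m * \<omega>1 + of_int n * \<omega>2 | m n. True}"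

text \<open>The product over the nonzero lattice points is the unconditional one: the limit of the
  finite subproducts, ordered by inclusion of the index sets.\<close>

definition weierstrass_sigma :: "complex \<Rightarrow> complex set \<Rightarrow> complex" where
  "weierstrass_sigma z L =
     z * Lim (finite_subsets_at_top (L - {0}))
           (\<lambda>F. \<Prod>\<omega>\<in>F. (1 - z / \<omega>) * exp (z / \<omega> + (z / \<omega>)\<^sup>2 / 2))"

definition weierstrass_zeta :: "complex \<Rightarrow> complex set \<Rightarrow> complex" where
  "weierstrass_zeta z L =
     1 / z + (\<Sum>\<^sub>\<infinity>\<omega>\<in>L - {0}. 1 / (z - \<omega>) + 1 / \<omega> + z / \<omega>\<^sup>2)"

text \<open>The guard \<open>z \<notin> L\<close> excludes the poles, where \<^const>\<open>weierstrass_zeta\<close> has a junk value.\<close>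

definition quasi_period :: "complex \<Rightarrow> complex set \<Rightarrow> complex" where
  "quasi_period \<omega> L =
     (THE h. \<forall>z. z \<notin> L \<longrightarrow> weierstrass_zeta (z + \<omega>) L = weierstrass_zeta z L + h)"

text \<open>The \<open>\<real>\<close>-linear extension of the quasi-period from \<open>L\<close> to \<open>\<complex>\<close>; it is unique because \<open>L\<close>
  spans \<open>\<complex>\<close> over \<open>\<real>\<close>.\<close>

definition eta_ext :: "complex \<Rightarrow> complex set \<Rightarrow> complex" where
  "eta_ext z L = (THE h. linear h \<and> (\<forall>\<omega>\<in>L. h \<omega> = quasi_period \<omega> L)) z"

definition psi :: "complex \<Rightarrow> complex set \<Rightarrow> complex" where
  "psi z L = (if z \<in> L - (\<lambda>\<omega>. 2 * \<omega>) ` L then -1 else 1)"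

definition SL2Z :: "(int ^ 2 ^ 2) set" where
  "SL2Z = {M. det M = 1}"

definition slash_mod ::
  "int \<Rightarrow> int ^ 2 ^ 2 \<Rightarrow> (complex \<Rightarrow> complex \<Rightarrow> complex) \<Rightarrow> complex \<Rightarrow> complex \<Rightarrow> complex" where
  "slash_mod k M \<phi> \<tau> z =
     (let a = of_int (M $ 1 $ 1); b = of_int (M $ 1 $ 2);
          c = of_int (M $ 2 $ 1); d = of_int (M $ 2 $ 2)
      in (c * \<tau> + d) powi (- k) * \<phi> ((a * \<tau> + b) / (c * \<tau> + d)) (z / (c * \<tau> + d)))"

definition slash_ell ::
  "int \<Rightarrow> real \<Rightarrow> real \<Rightarrow> (complex \<Rightarrow> complex \<Rightarrow> complex) \<Rightarrow> complex \<Rightarrow> complex \<Rightarrow> complex" where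
  "slash_ell k l m \<phi> \<tau> z =
     (let \<omega> = of_real l * \<tau> + of_real m; L = period_lattice \<tau> 1
      in (psi \<omega> L * exp (eta_ext \<omega> L * (z + \<omega> / 2))) powi k * \<phi> \<tau> (z + \<omega>))"

definition rho :: "complex \<Rightarrow> complex \<Rightarrow> complex" where
  "rho \<tau> z = exp (eta_ext 1 (period_lattice \<tau> 1) * z\<^sup>2 / 2 - of_real pi * \<i> * z)"

text \<open>Holomorphy in two variables on an open set: the Frechet derivative exists at every point and is
  complex linear.\<close>

definition holomorphic2_on ::
  "(complex \<Rightarrow> complex \<Rightarrow> complex) \<Rightarrow> (complex \<times> complex) set \<Rightarrow> bool" where
  "holomorphic2_on \<phi> S \<longleftrightarrow>
     (\<forall>p\<in>S. \<exists>A B. ((\<lambda>(\<tau>, z). \<phi> \<tau> z) has_derivative (\<lambda>(u, v). A * u + B * v)) (at p))"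

text \<open>Functions on \<open>\<HH> \<times> \<complex>\<close> are total functions of which only the values at \<open>\<tau> \<in> \<HH>\<close> are
  constrained. Intended for \<open>\<Gamma> \<subseteq> SL\<^sub>2(\<int>)\<close> a subgroup of finite index. A strictly increasing \<open>r0\<close>
  cannot satisfy \<open>r0 n / n \<rightarrow> 0\<close>, so increasing means \<^const>\<open>mono\<close>.\<close>

definition jacobi_forms ::
  "int \<Rightarrow> (int ^ 2 ^ 2) set \<Rightarrow> (complex \<Rightarrow> complex \<Rightarrow> complex) set" where
  "jacobi_forms k \<Gamma> = {\<phi>.
     holomorphic2_on \<phi> (upper_half_plane \<times> UNIV) \<and>
     (\<forall>M\<in>\<Gamma>. \<forall>\<tau>\<in>upper_half_plane. \<forall>z. slash_mod k M \<phi> \<tau> z = \<phi> \<tau> z) \<and>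
     (\<forall>(l::int) (m::int). \<forall>\<tau>\<in>upper_half_plane. \<forall>z.
        slash_ell k (of_int l) (of_int m) \<phi> \<tau> z = \<phi> \<tau> z) \<and>
     (\<forall>M\<in>SL2Z. \<exists>(r0 :: nat \<Rightarrow> nat) (c :: nat \<Rightarrow> int \<Rightarrow> complex).
        mono r0 \<and> (\<lambda>n. real (r0 n) / real n) \<longlonglongrightarrow> 0 \<and>
        (\<forall>\<tau>\<in>upper_half_plane. \<forall>z.
           (\<lambda>n. \<Sum>r | \<bar>r\<bar> \<le> int (r0 n). c n r * unit_exp \<tau> ^ n * unit_exp z powi r) sums
             (rho \<tau> z powi k * slash_mod k M \<phi> \<tau> z)))}"

end

theory Submission
  imports Defs "HOL-Complex_Analysis.Complex_Analysis" "HOL-Real_Asymp.Real_Asymp"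
begin

text \<open>
  The lattice product and the lattice sum converge absolutely, hence may be evaluated as iterated
  limits over boxes \<open>\<bar>m\<bar> \<le> M\<close>, \<open>\<bar>n\<bar> \<le> N\<close>, letting \<open>N\<close> tend to infinity first. Each row \<open>m\<close> then contributes
  a quotient of sines to \<open>\<sigma>\<close> and a cotangent to the Weierstrass zeta function, so translation by \<open>1\<close> and \<open>\<tau>\<close> telescopes: with
  \<open>G\<^sub>2 = lim\<^sub>M \<Sum>\<^sub>|\<^sub>m\<^sub>|\<^sub>\<le>\<^sub>M \<Sum>\<^sub>n 1 / (m\<tau> + n)\<^sup>2\<close> one finds \<open>\<eta>(l\<tau> + m) = G\<^sub>2 (l\<tau> + m) - 2\<pi>il\<close> and the translation law
  of \<open>\<sigma>\<close>. The modular law is the homogeneity \<open>\<sigma>(cz, cL) = c \<sigma>(z, L)\<close>. Finally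
  \<open>\<rho>\<^sup>-\<^sup>1 \<sigma> = (\<zeta> - 1) / (2\<pi>i) \<Prod>\<^sub>m (1 - q\<^sup>m\<zeta>) (1 - q\<^sup>m/\<zeta>) / (1 - q\<^sup>m)\<^sup>2\<close> with \<open>\<zeta> = e(z)\<close>. The partial products
  contain \<open>q\<^sup>n \<zeta>\<^sup>r\<close> only for \<open>r(r - 1) \<le> 2n\<close>, and the
  coefficient of \<open>q\<^sup>n\<close> no longer changes after the factor \<open>m = n\<close>.
\<close>

section \<open>Unconditional products and holomorphy in two variables\<close>

text \<open>The sum of 1/\<omega>^2 over the lattice does not converge absolutely, so the order of
  exhaustion matters as soon as the terms of zeta or the factors of \<sigma> are taken apart. Using
  the same boxes for both functions makes the same number G2 appear in both, and the translation law
  of \<sigma> is then matched with \<eta> by comparing explicit exponents. Since \<eta>(1) = G2,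
  multiplying by 1/\<rho> strips exactly exp(G2 z^2/2) from \<sigma> and leaves a theta quotient.
  The bound r(r - 1) \<le> 2n is the parabola of theta: the exponent r = k + 1 of \<zeta> uses one
  linear term from each of k different factors, which costs at least q^(1 + ... + k); negative
  exponents r = -k behave alike. The growth condition for every matrix reduces to the identity
  matrix because \<sigma> is invariant under the full modular group.\<close>

lemma norm_prod_one_plus_minus_one_le:
  fixes w :: "'i \<Rightarrow> 'a :: {real_normed_field}"
  assumes "finite A" "\<And>i. i \<in> A \<Longrightarrow> norm (w i) \<le> b i"
  shows "norm ((\<Prod>i\<in>A. 1 + w i) - 1) \<le> exp (sum b A) - 1"
  using assms
proof (induction A rule: finite_induct)
  case (insert x A)
  let ?P = "\<Prod>i\<in>A. 1 + w i"
  have b: "norm (w x) \<le> b x" and IH: "norm (?P - 1) \<le> exp (sum b A) - 1"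
    using insert by auto
  have b0: "0 \<le> b x" using b norm_ge_zero order_trans by blast
  have "(\<Prod>i\<in>insert x A. 1 + w i) - 1 = (?P - 1) * (1 + w x) + w x"
    using insert by (simp add: algebra_simps)
  also have "norm \<dots> \<le> norm (?P - 1) * (1 + norm (w x)) + norm (w x)"
    by (rule order_trans[OF norm_triangle_ineq])
       (auto simp: norm_mult intro!: mult_left_mono order_trans[OF norm_triangle_ineq])
  also have "\<dots> \<le> (exp (sum b A) - 1) * (1 + b x) + b x"
    using b b0 IH order_trans[OF norm_ge_zero IH] by (intro add_mono mult_mono) auto
  also have "\<dots> = exp (sum b A) * (1 + b x) - 1" by (simp add: algebra_simps)
  also have "\<dots> \<le> exp (sum b A) * exp (b x) - 1"
    by (intro diff_right_mono mult_left_mono) auto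
  finally show ?case using insert by (simp add: exp_add mult.commute)
qed auto

text \<open>The difference of the two products is the product over A times the product over B - A
  minus 1, so the tail of \<open>b\<close> controls it without dividing by possibly vanishing
  factors.\<close>

lemma norm_prod_one_plus_diff_le:
  fixes w :: "'i \<Rightarrow> 'a :: {real_normed_field}"
  assumes "finite B" "A \<subseteq> B" "\<And>i. i \<in> B \<Longrightarrow> norm (w i) \<le> b i"
  shows "norm ((\<Prod>i\<in>B. 1 + w i) - (\<Prod>i\<in>A. 1 + w i)) \<le> exp (sum b A) * (exp (sum b (B - A)) - 1)"
proof -
  have fA: "finite A" using assms finite_subset by blast
  have "norm (\<Prod>i\<in>A. 1 + w i) \<le> norm ((\<Prod>i\<in>A. 1 + w i) - 1) + 1"
    using norm_triangle_ineq[of "(\<Prod>i\<in>A. 1 + w i) - 1" 1] by simp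
  also have "\<dots> \<le> exp (sum b A)"
    using norm_prod_one_plus_minus_one_le[of A w b] assms fA by fastforce
  finally have 1: "norm (\<Prod>i\<in>A. 1 + w i) \<le> exp (sum b A)" .
  have 2: "norm ((\<Prod>i\<in>B-A. 1 + w i) - 1) \<le> exp (sum b (B-A)) - 1"
    using assms by (intro norm_prod_one_plus_minus_one_le) auto
  have "(\<Prod>i\<in>B. 1 + w i) = (\<Prod>i\<in>A. 1 + w i) * (\<Prod>i\<in>B-A. 1 + w i)"
    using assms by (simp add: prod.subset_diff mult.commute)
  then have "(\<Prod>i\<in>B. 1 + w i) - (\<Prod>i\<in>A. 1 + w i) = (\<Prod>i\<in>A. 1 + w i) * ((\<Prod>i\<in>B-A. 1 + w i) - 1)"
    by (simp add: algebra_simps)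
  then show ?thesis using 1 2 by (simp add: norm_mult mult_mono)
qed

text \<open>The majorant \<open>b\<close> does not depend on x, so one finite set F0 serves all
  points of X at once; uniformity comes with convergence.\<close>

proposition uniform_limit_unconditional_prod:
  fixes w :: "'i \<Rightarrow> 'x \<Rightarrow> 'a :: {real_normed_field, banach}"
  assumes b: "b summable_on A" and w: "\<And>i x. i \<in> A \<Longrightarrow> x \<in> X \<Longrightarrow> norm (w i x) \<le> b i"
  shows "uniform_limit X (\<lambda>F x. \<Prod>i\<in>F. 1 + w i x)
           (\<lambda>x. Lim (finite_subsets_at_top A) (\<lambda>F. \<Prod>i\<in>F. 1 + w i x)) (finite_subsets_at_top A)"
proof (cases "X = {}")
  case False
  then obtain x0 where "x0 \<in> X" by blast
  then have b0: "0 \<le> b i" if "i \<in> A" for i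
    using w[OF that] norm_ge_zero order_trans by blast
  define P where "P = (\<lambda>F x. \<Prod>i\<in>F. 1 + w i x)"
  define S where "S = infsum b A"
  have close: "\<exists>F0. finite F0 \<and> F0 \<subseteq> A \<and>
      (\<forall>F. finite F \<and> F0 \<subseteq> F \<and> F \<subseteq> A \<longrightarrow> (\<forall>x\<in>X. norm (P F x - P F0 x) \<le> e))" if "e > 0" for e
  proof -
    \<comment> \<open>Solves exp S * (exp d - 1) = e, the bound that the tail estimate
      produces.\<close>
    define d where "d = ln (1 + e / exp S)"
    have d: "d > 0" using \<open>e > 0\<close> by (simp add: d_def ln_gt_zero add_pos_pos)
    have "(sum b \<longlongrightarrow> S) (finite_subsets_at_top A)"
      using has_sum_infsum[OF b] by (simp add: has_sum_def S_def)
    then have "\<forall>\<^sub>F F in finite_subsets_at_top A. dist (sum b F) S < d"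
      using d tendstoD by blast
    then obtain F0 where F0: "finite F0" "F0 \<subseteq> A"
      "\<And>F. finite F \<Longrightarrow> F0 \<subseteq> F \<Longrightarrow> F \<subseteq> A \<Longrightarrow> dist (sum b F) S < d"
      by (auto simp: eventually_finite_subsets_at_top)
    have le: "sum b F \<le> S" if "finite F" "F \<subseteq> A" for F
      unfolding S_def using that b b0 by (intro finite_sum_le_infsum) auto
    have "norm (P F x - P F0 x) \<le> e" if F: "finite F" "F0 \<subseteq> F" "F \<subseteq> A" "x \<in> X" for F x
    proof -
      have "sum b (F - F0) = sum b F - sum b F0"
        using F F0 by (intro sum_diff) auto
      also have "\<dots> \<le> d"
        using le[OF F(1) F(3)] F0(3)[OF F0(1) order_refl F0(2)] by (simp add: dist_real_def)
      finally have sd: "sum b (F - F0) \<le> d" .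
      have "norm (P F x - P F0 x) \<le> exp (sum b F0) * (exp (sum b (F - F0)) - 1)"
        unfolding P_def using F w by (intro norm_prod_one_plus_diff_le) auto
      also have "\<dots> \<le> exp S * (exp d - 1)"
        using le[OF F0(1,2)] sd F b0 by (intro mult_mono) (auto intro!: sum_nonneg)
      also have "\<dots> = e" using \<open>e > 0\<close> by (simp add: d_def add_pos_pos)
      finally show ?thesis .
    qed
    then show ?thesis by (intro exI[of _ F0]) (use F0 in auto)
  qed
  have nt: "finite_subsets_at_top A \<noteq> bot" by simp
  \<comment> \<open>\<open>Lim\<close> equals the limit only if one exists. Completeness provides
    it, since the partial products form a Cauchy filter.\<close>
  have lim: "((\<lambda>F. P F x) \<longlongrightarrow> Lim (finite_subsets_at_top A) (\<lambda>F. P F x)) (finite_subsets_at_top A)"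
    if x: "x \<in> X" for x
  proof -
    have "cauchy_filter (filtermap (\<lambda>F. P F x) (finite_subsets_at_top A))"
      unfolding cauchy_filter_metric_filtermap
    proof (intro allI impI)
      fix e :: real assume "e > 0"
      then have e: "e/3 > 0" by simp
      obtain F0 where F0: "finite F0" "F0 \<subseteq> A"
        "\<forall>F. finite F \<and> F0 \<subseteq> F \<and> F \<subseteq> A \<longrightarrow> (\<forall>x\<in>X. norm (P F x - P F0 x) \<le> e/3)"
        using close[OF e] by (elim exE conjE)
      have "dist (P F x) (P G x) < e"
        if "finite F" "F0 \<subseteq> F" "F \<subseteq> A" "finite G" "F0 \<subseteq> G" "G \<subseteq> A" for F G
      proof -
        have "norm (P F x - P G x) \<le> norm (P F x - P F0 x) + norm (P G x - P F0 x)"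
          by (rule norm_diff_triangle_le[where y = "P F0 x"]) (auto simp: norm_minus_commute)
        also have "\<dots> \<le> e/3 + e/3" using F0(3) that x by (intro add_mono) auto
        finally show ?thesis using e by (simp add: dist_norm)
      qed
      then show "\<exists>Q. eventually Q (finite_subsets_at_top A) \<and>
          (\<forall>F G. Q F \<and> Q G \<longrightarrow> dist (P F x) (P G x) < e)"
        using F0(1,2)
        by (intro exI[of _ "\<lambda>F. finite F \<and> F0 \<subseteq> F \<and> F \<subseteq> A"])
           (auto simp: eventually_finite_subsets_at_top)
    qed
    then obtain l where "filtermap (\<lambda>F. P F x) (finite_subsets_at_top A) \<le> nhds l"
      using cauchy_filter_complete_converges[OF _ complete_UNIV]
      by (metis UNIV_I filtermap_bot_iff nt principal_UNIV top_greatest)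
    then have "((\<lambda>F. P F x) \<longlongrightarrow> l) (finite_subsets_at_top A)" by (simp add: filterlim_def)
    then show ?thesis using tendsto_Lim[OF nt] by blast
  qed
  have "uniform_limit X P (\<lambda>x. Lim (finite_subsets_at_top A) (\<lambda>F. P F x)) (finite_subsets_at_top A)"
  proof (rule uniform_limitI)
    fix e :: real assume "e > 0"
    then have e: "e/3 > 0" by simp
    obtain F0 where F0: "finite F0" "F0 \<subseteq> A"
      "\<forall>F. finite F \<and> F0 \<subseteq> F \<and> F \<subseteq> A \<longrightarrow> (\<forall>x\<in>X. norm (P F x - P F0 x) \<le> e/3)"
      using close[OF e] by (elim exE conjE)
    have "dist (P F x) (Lim (finite_subsets_at_top A) (\<lambda>F. P F x)) < e"
      if F: "finite F" "F0 \<subseteq> F" "F \<subseteq> A" "x \<in> X" for F x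
    proof -
      let ?l = "Lim (finite_subsets_at_top A) (\<lambda>F. P F x)"
      have "((\<lambda>F. norm (P F x - P F0 x)) \<longlongrightarrow> norm (?l - P F0 x)) (finite_subsets_at_top A)"
        by (intro tendsto_intros lim F)
      moreover have "\<forall>\<^sub>F F in finite_subsets_at_top A. norm (P F x - P F0 x) \<le> e/3"
        unfolding eventually_finite_subsets_at_top
        by (intro exI[of _ F0]) (use F0 F(4) in blast)
      ultimately have "norm (?l - P F0 x) \<le> e/3"
        using nt by (rule tendsto_upperbound)
      moreover have "norm (P F x - P F0 x) \<le> e/3" using F0 F by auto
      ultimately have "norm (P F x - ?l) \<le> e/3 + e/3"
        by (intro norm_diff_triangle_le[where y = "P F0 x"]) (auto simp: norm_minus_commute)
      then show ?thesis using e by (simp add: dist_norm)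
    qed
    then show "\<forall>\<^sub>F F in finite_subsets_at_top A.
        \<forall>x\<in>X. dist (P F x) (Lim (finite_subsets_at_top A) (\<lambda>F. P F x)) < e"
      unfolding eventually_finite_subsets_at_top
      by (intro exI[of _ F0]) (use F0(1,2) in blast)
  qed
  then show ?thesis unfolding P_def .
qed auto

text \<open>Beyond some K every box with M, N \<ge> K contains the decisive finite set, so its value
  is within e/2 of S; letting N tend to infinity preserves this bound. The inner limits may
  therefore exist for each M without any uniformity in M.\<close>

lemma iterated_limit_of_unconditional:
  fixes S :: "'a :: metric_space" and B :: "nat \<Rightarrow> nat \<Rightarrow> 'i set"
  assumes P: "(P \<longlongrightarrow> S) (finite_subsets_at_top A)"
    and B: "\<And>M N. finite (B M N)" "\<And>M N. B M N \<subseteq> A"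
    and cov: "\<And>x. x \<in> A \<Longrightarrow> \<exists>k. \<forall>M\<ge>k. \<forall>N\<ge>k. x \<in> B M N"
    and R: "\<And>M. (\<lambda>N. P (B M N)) \<longlonglongrightarrow> R M"
  shows "R \<longlonglongrightarrow> S"
proof (rule metric_LIMSEQ_I)
  fix e :: real assume "e > 0"
  then have "\<forall>\<^sub>F F in finite_subsets_at_top A. dist (P F) S < e/2"
    by (intro tendstoD[OF P]) auto
  then obtain F0 where F0: "finite F0" "F0 \<subseteq> A"
    "\<And>F. finite F \<Longrightarrow> F0 \<subseteq> F \<Longrightarrow> F \<subseteq> A \<Longrightarrow> dist (P F) S < e/2"
    by (auto simp: eventually_finite_subsets_at_top)
  obtain k where k: "\<And>x M N. x \<in> A \<Longrightarrow> M \<ge> k x \<Longrightarrow> N \<ge> k x \<Longrightarrow> x \<in> B M N"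
    using cov by metis
  define K where "K = Max (insert 0 (k ` F0))"
  have K: "k x \<le> K" if "x \<in> F0" for x using that F0(1) by (auto simp: K_def)
  have sub: "F0 \<subseteq> B M N" if "M \<ge> K" "N \<ge> K" for M N
    using k K F0(2) that by (meson order_trans subsetD subsetI)
  have "dist (R M) S < e" if "M \<ge> K" for M
  proof -
    have "(\<lambda>N. dist (P (B M N)) S) \<longlonglongrightarrow> dist (R M) S" by (intro tendsto_intros R)
    moreover have "\<forall>\<^sub>F N in sequentially. dist (P (B M N)) S \<le> e/2"
      using eventually_ge_at_top[of K]
      by eventually_elim (use F0(3)[OF B(1) sub[OF that] B(2)] in \<open>auto intro: less_imp_le\<close>)
    ultimately have "dist (R M) S \<le> e/2" using tendsto_upperbound by fastforce
    with \<open>e > 0\<close> show ?thesis by simp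
  qed
  then show "\<exists>no. \<forall>n\<ge>no. dist (R n) S < e" by blast
qed

text \<open>Partial derivatives give a Frechet derivative once one of them is jointly continuous.
  Joint continuity of the z-derivative is obtained from that of f by Cauchy's estimate.\<close>

proposition holomorphic2_onI:
  fixes f :: "complex \<Rightarrow> complex \<Rightarrow> complex"
  assumes U: "open U" and V: "open V"
    and cont: "continuous_on (U \<times> V) (\<lambda>(\<tau>, z). f \<tau> z)"
    and holz: "\<And>\<tau>. \<tau> \<in> U \<Longrightarrow> f \<tau> holomorphic_on V"
    and hol\<tau>: "\<And>z. z \<in> V \<Longrightarrow> (\<lambda>\<tau>. f \<tau> z) holomorphic_on U"
  shows "holomorphic2_on f (U \<times> V)"
  unfolding holomorphic2_on_def
proof (safe)
  fix t0 z0 assume t0: "t0 \<in> U" and z0: "z0 \<in> V"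
  obtain r1 where r1: "r1 > 0" "cball t0 r1 \<subseteq> U" using U t0 open_contains_cball by blast
  obtain r2 where r2: "r2 > 0" "cball z0 r2 \<subseteq> V" using V z0 open_contains_cball by blast
  define D where "D = (\<lambda>t z. deriv (f t) z)"
  \<comment> \<open>Half the radius: a centre moved by less than s, with a disc of radius s around
    it, stays inside \<open>cball z0 r2\<close>.\<close>
  define s where "s = r2 / 2"
  have s: "s > 0" using r2 by (simp add: s_def)
  let ?K = "cball t0 r1 \<times> cball z0 r2"
  have "uniformly_continuous_on ?K (\<lambda>(t, z). f t z)"
    using r1 r2 by (intro compact_uniformly_continuous continuous_on_subset[OF cont] compact_Times) auto
  have Dlim: "((\<lambda>p. D (fst p) (snd p)) \<longlongrightarrow> D t0 z0) (at (t0, z0))"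
  proof (rule tendstoI)
    fix e :: real assume e: "e > 0"
    then have "e / 2 * s > 0" using s by simp
    then obtain d where d: "d > 0"
      "\<And>p q. p \<in> ?K \<Longrightarrow> q \<in> ?K \<Longrightarrow> dist q p < d \<Longrightarrow>
          dist (f (fst q) (snd q)) (f (fst p) (snd p)) < e / 2 * s"
      using \<open>uniformly_continuous_on ?K _\<close>
      unfolding uniformly_continuous_on_def case_prod_beta by blast
    define d' where "d' = min d (min s r1)"
    have d': "d' > 0" using d s r1 by (simp add: d'_def)
    have "dist (D (fst p) (snd p)) (D t0 z0) < e" if p: "dist p (t0, z0) < d'" for p
    proof -
      obtain t z where pt: "p = (t, z)" by fastforce
      have dt: "dist t t0 < d'" and dz: "dist z z0 < d'"
        using dist_fst_le[of p "(t0,z0)"] dist_snd_le[of p "(t0,z0)"] p pt by auto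
      have tU: "t \<in> cball t0 r1" using dt by (auto simp: d'_def dist_commute)
      have tU': "t \<in> U" using tU r1 by auto
      have sh: "w + (z - z0) \<in> cball z0 r2" if "w \<in> cball z0 s" for w
      proof -
        have "dist (w + (z - z0)) z0 \<le> norm (w - z0) + norm (z - z0)"
          unfolding dist_norm by (rule order_trans[OF _ norm_triangle_ineq]) simp
        also have "\<dots> \<le> s + s"
          using that dz by (intro add_mono) (auto simp: d'_def dist_norm norm_minus_commute)
        finally show ?thesis by (simp add: s_def dist_commute)
      qed
      have sV: "cball z0 s \<subseteq> cball z0 r2" using r2 by (intro cball_subset_cball_iff[THEN iffD2]) (auto simp: s_def)
      \<comment> \<open>Translating \<open>f t\<close> so that z lands on z0 makes the derivative of
        g at z0 equal to D t z - D t0 z0. Uniform continuity makes g small on the circle of radius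
        s, and Cauchy's inequality carries this over to the derivative.\<close>
      define g where "g = (\<lambda>w. f t (w + (z - z0)) - f t0 w)"
      have holg: "g holomorphic_on cball z0 s"
        unfolding g_def
        using sh sV r2
        by (intro holomorphic_on_diff holomorphic_on_subset[OF holz[OF t0]]
              holomorphic_on_compose_gen[OF _ holz[OF tU'], unfolded o_def] holomorphic_intros) auto
      have bound: "norm (g w) \<le> e / 2 * s" if "norm (z0 - w) = s" for w
      proof -
        have w: "w \<in> cball z0 s" using that by (simp add: dist_norm)
        have "dist (t, w + (z - z0)) (t0, w) = dist p (t0, z0)"
          by (simp add: pt dist_Pair_Pair dist_norm)
        then have "dist (f t (w + (z - z0))) (f t0 w) < e / 2 * s"
          using d(2)[of "(t0, w)" "(t, w + (z - z0))"] sh[OF w] sV w tU p r1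
          by (auto simp: d'_def)
        then show ?thesis by (simp add: g_def dist_norm)
      qed
      have "norm ((deriv ^^ 1) g z0) \<le> fact 1 * (e / 2 * s) / s ^ 1"
        by (intro Cauchy_inequality bound s holomorphic_on_subset[OF holg]
              holomorphic_on_imp_continuous_on[OF holg]) auto
      then have "norm (deriv g z0) \<le> e / 2" using s by simp
      moreover have "(g has_field_derivative (D t z - D t0 z0)) (at z0)"
      proof -
        have zV: "z \<in> V" using sh[of z0] s r2 by auto
        have "(f t has_field_derivative D t z) (at z)"
          using holz[OF tU'] zV V unfolding D_def by (simp add: holomorphic_derivI)
        then have "(f t has_field_derivative D t z) (at (z0 + (z - z0)))" by simp
        then have 1: "((\<lambda>w. f t (w + (z - z0))) has_field_derivative D t z) (at z0)"
          by (subst (asm) DERIV_shift)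
        have "(f t0 has_field_derivative D t0 z0) (at z0)"
          using holz[OF t0] z0 V unfolding D_def by (simp add: holomorphic_derivI)
        with 1 show ?thesis unfolding g_def by (rule DERIV_diff)
      qed
      ultimately show ?thesis
        using e by (simp add: DERIV_imp_deriv dist_norm pt)
    qed
    then show "\<forall>\<^sub>F p in at (t0, z0). dist (D (fst p) (snd p)) (D t0 z0) < e"
      using d' by (auto simp: eventually_at)
  qed
  define A where "A = deriv (\<lambda>t. f t z0) t0"
  have "((\<lambda>t. f t z0) has_field_derivative A) (at t0 within ball t0 r1)"
    using hol\<tau>[OF z0] U t0 unfolding A_def by (blast intro: has_field_derivative_at_within[OF holomorphic_derivI])
  then have fx: "((\<lambda>t. f t z0) has_derivative (*) A) (at t0 within ball t0 r1)"
    by (simp add: has_field_derivative_def)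
  have fy: "(f t has_derivative blinfun_apply (blinfun_mult_right (D t z))) (at z within ball z0 r2)"
    if "t \<in> ball t0 r1" "z \<in> ball z0 r2" for t z
  proof -
    have "t \<in> U" "z \<in> V" using that r1 r2 by auto
    then have "(f t has_field_derivative D t z) (at z within ball z0 r2)"
      using holz V unfolding D_def by (blast intro: has_field_derivative_at_within[OF holomorphic_derivI])
    then show ?thesis by (simp add: has_field_derivative_def blinfun_mult_right.rep_eq)
  qed
  have "continuous (at (t0, z0) within ball t0 r1 \<times> ball z0 r2)
          (\<lambda>(t, z). blinfun_mult_right (D t z))"
    unfolding continuous_within case_prod_beta
    using bounded_linear.tendsto[OF bounded_linear_blinfun_mult_right tendsto_within_subset[OF Dlim]]
    by simp
  from has_derivative_partialsI[OF fx fy this] r2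
  have "((\<lambda>(t, z). f t z) has_derivative (\<lambda>(u, v). A * u + D t0 z0 * v))
          (at (t0, z0) within ball t0 r1 \<times> ball z0 r2)"
    by (simp add: blinfun_mult_right.rep_eq)
  moreover have "at (t0, z0) within ball t0 r1 \<times> ball z0 r2 = at (t0, z0)"
    using r1 r2 by (intro at_within_open) (auto intro: open_Times)
  ultimately show "\<exists>A B. ((\<lambda>(\<tau>, z). f \<tau> z) has_derivative (\<lambda>(u, v). A * u + B * v)) (at (t0, z0))"
    by auto
qed

section \<open>Lattice sums and products\<close>

definition lattice_pt :: "complex \<Rightarrow> int \<times> int \<Rightarrow> complex" where
  "lattice_pt \<tau> p = of_int (fst p) * \<tau> + of_int (snd p)"

abbreviation nonzero_pts :: "(int \<times> int) set" where
  "nonzero_pts \<equiv> UNIV - {0}"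

lemma period_lattice_eq_range: "period_lattice \<tau> 1 = range (lattice_pt \<tau>)"
  by (auto simp: period_lattice_def lattice_pt_def image_def)

lemma lattice_pt_eq_0_iff:
  assumes "Im \<tau> > 0" shows "lattice_pt \<tau> p = 0 \<longleftrightarrow> p = 0"
proof
  assume a: "lattice_pt \<tau> p = 0"
  then have "Im (lattice_pt \<tau> p) = 0" by simp
  then have "fst p = 0" using assms by (simp add: lattice_pt_def)
  with a show "p = 0" by (simp add: lattice_pt_def prod_eq_iff)
qed (simp add: lattice_pt_def)

lemma lattice_pt_0 [simp]: "lattice_pt \<tau> 0 = 0" by (simp add: lattice_pt_def)

lemma lattice_pt_diff: "lattice_pt \<tau> (p - p') = lattice_pt \<tau> p - lattice_pt \<tau> p'"
  by (simp add: lattice_pt_def algebra_simps)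

lemma lattice_pt_minus: "lattice_pt \<tau> (- p) = - lattice_pt \<tau> p"
  by (simp add: lattice_pt_def)

lemma inj_lattice_pt:
  assumes "Im \<tau> > 0" shows "inj (lattice_pt \<tau>)"
  by (rule injI) (metis assms lattice_pt_diff lattice_pt_eq_0_iff right_minus_eq)

lemma period_lattice_minus_0:
  assumes "Im \<tau> > 0" shows "period_lattice \<tau> 1 - {0} = lattice_pt \<tau> ` nonzero_pts"
  using lattice_pt_eq_0_iff[OF assms] by (auto simp: period_lattice_eq_range)

text \<open>A majorant for |\<omega>|^(-3), up to a constant, in product form: (1 + |m|)(1 + |n|) is
  at most a constant times |\<omega>|^2, and 2 * (3/2) = 3. The variables separate, so summability
  reduces to one dimension, where the exponent 3/2 > 1 suffices.\<close>

definition lattice_weight :: "int \<times> int \<Rightarrow> real" where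
  "lattice_weight p = ((1 + \<bar>real_of_int (fst p)\<bar>) * (1 + \<bar>real_of_int (snd p)\<bar>)) powr (-3/2)"

lemma summable_on_int_powr: "(\<lambda>n::int. (1 + \<bar>real_of_int n\<bar>) powr (-3/2)) summable_on UNIV"
proof -
  let ?f = "\<lambda>n::int. (1 + \<bar>real_of_int n\<bar>) powr (-3/2)"
  have "summable (\<lambda>n. real n powr (-3/2))" by (subst summable_real_powr_iff) simp
  then have "summable (\<lambda>n. real (Suc n) powr (-3/2))" by (subst summable_Suc_iff)
  then have 1: "(\<lambda>n. real (Suc n) powr (-3/2)) summable_on UNIV"
    by (subst summable_on_UNIV_nonneg_real_iff) auto
  have "?f summable_on range int"
    by (subst summable_on_reindex) (use 1 in \<open>auto simp: o_def\<close>)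
  moreover have "?f summable_on range (\<lambda>n. - int n)"
    by (subst summable_on_reindex) (use 1 in \<open>auto simp: o_def inj_on_def\<close>)
  ultimately have "?f summable_on (range int \<union> range (\<lambda>n. - int n))"
    by (rule summable_on_union)
  moreover have "range int \<union> range (\<lambda>n. - int n) = UNIV"
  proof -
    have "x \<in> range int \<union> range (\<lambda>n. - int n)" for x
      by (cases x rule: int_cases2) auto
    then show ?thesis by blast
  qed
  ultimately show ?thesis by simp
qed

lemma lattice_weight_nonneg: "0 \<le> lattice_weight p" by (simp add: lattice_weight_def)

lemma summable_on_lattice_weight: "lattice_weight summable_on A"
proof -
  let ?f = "\<lambda>n::int. (1 + \<bar>real_of_int n\<bar>) powr (-3/2)"
  have "(\<lambda>p. lattice_weight p) summable_on Sigma UNIV (\<lambda>_. UNIV)"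
  proof (rule summable_on_SigmaI)
    show "((\<lambda>n. lattice_weight (m, n)) has_sum ?f m * infsum ?f UNIV) UNIV" for m
      unfolding lattice_weight_def using has_sum_infsum[OF summable_on_int_powr]
      by (auto simp: powr_mult intro: has_sum_cmult_right)
    show "(\<lambda>m. ?f m * infsum ?f UNIV) summable_on UNIV"
      by (intro summable_on_cmult_left summable_on_int_powr)
  qed (simp add: lattice_weight_def)
  then have "lattice_weight summable_on UNIV" by simp
  then show ?thesis
    using lattice_weight_nonneg by (rule_tac summable_on_subset_banach) auto
qed

text \<open>Here y bounds Im \<tau> from below and R bounds |\<tau>| from above. Then |m| \<le>
  |\<omega>| / y and |n| \<le> (1 + R/y) |\<omega>|; the constant is the sum of the two factors and
  hence serves for both coordinates, uniformly in \<tau>.\<close>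

definition lattice_const :: "real \<Rightarrow> real \<Rightarrow> real" where
  "lattice_const y R = 1 / y + 1 + R / y"

lemma lattice_const_pos: "y > 0 \<Longrightarrow> R \<ge> 0 \<Longrightarrow> lattice_const y R > 0"
  by (simp add: lattice_const_def add_pos_nonneg)

lemma lattice_coeff_le_norm:
  assumes y: "y > 0" "y \<le> Im \<tau>" "norm \<tau> \<le> R"
  shows "\<bar>real_of_int (fst p)\<bar> \<le> lattice_const y R * norm (lattice_pt \<tau> p)"
    and "\<bar>real_of_int (snd p)\<bar> \<le> lattice_const y R * norm (lattice_pt \<tau> p)"
proof -
  let ?w = "lattice_pt \<tau> p" and ?m = "\<bar>real_of_int (fst p)\<bar>" and ?n = "\<bar>real_of_int (snd p)\<bar>"
  have R: "R \<ge> 0" using assms norm_ge_zero order_trans by blast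
  have "?m * y \<le> ?m * Im \<tau>" using y by (intro mult_left_mono) auto
  also have "\<dots> = \<bar>Im ?w\<bar>" using y by (simp add: lattice_pt_def abs_mult)
  also have "\<dots> \<le> norm ?w" by (rule abs_Im_le_cmod)
  finally have m: "?m \<le> 1 / y * norm ?w" using y by (simp add: field_simps)
  have "?n = norm (?w - of_int (fst p) * \<tau>)" by (simp add: lattice_pt_def)
  also have "\<dots> \<le> norm ?w + ?m * norm \<tau>"
    by (rule order_trans[OF norm_triangle_ineq4]) (simp add: norm_mult)
  also have "\<dots> \<le> norm ?w + (1 / y * norm ?w) * R"
    using m y by (intro add_left_mono mult_mono) auto
  finally have n: "?n \<le> (1 + R / y) * norm ?w" by (simp add: algebra_simps)
  have "1 / y * norm ?w \<le> lattice_const y R * norm ?w"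
    using y R by (intro mult_right_mono) (auto simp: lattice_const_def)
  with m show "?m \<le> lattice_const y R * norm ?w" by simp
  have "(1 + R / y) * norm ?w \<le> lattice_const y R * norm ?w"
    using y R by (intro mult_right_mono) (auto simp: lattice_const_def)
  with n show "?n \<le> lattice_const y R * norm ?w" by simp
qed

text \<open>Some coordinate of p is a nonzero integer, which gives 1 \<le> C|\<omega>|. Then 1 + |m|
  and 1 + |n| are both at most 2C|\<omega>|, whence the factor 8 = 2^3 after raising to the power
  3/2.\<close>

lemma
  assumes y: "y > 0" "y \<le> Im \<tau>" "norm \<tau> \<le> R" and p: "p \<noteq> 0"
  shows norm_lattice_pt_ge: "1 \<le> lattice_const y R * norm (lattice_pt \<tau> p)"
    and inverse_norm_lattice_pt_cubed_le:
      "1 / norm (lattice_pt \<tau> p) ^ 3 \<le> 8 * lattice_const y R ^ 3 * lattice_weight p"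
proof -
  let ?w = "lattice_pt \<tau> p" and ?m = "\<bar>real_of_int (fst p)\<bar>" and ?n = "\<bar>real_of_int (snd p)\<bar>"
  let ?C = "lattice_const y R"
  let ?x = "?C * norm ?w"
  have R: "R \<ge> 0" using assms norm_ge_zero order_trans by blast
  have C: "?C > 0" using lattice_const_pos y R by blast
  note mn = lattice_coeff_le_norm[OF y, of p]
  have "fst p \<noteq> 0 \<or> snd p \<noteq> 0" using p by (auto simp: prod_eq_iff)
  then have "1 \<le> ?m \<or> 1 \<le> ?n" by linarith
  with mn show x: "1 \<le> ?x" by linarith
  then have w: "norm ?w > 0" by (cases "?w = 0") auto
  have "(1 + ?m) * (1 + ?n) \<le> (2 * ?x) * (2 * ?x)"
    using mn x by (intro mult_mono) linarith+
  also have "\<dots> = (2 * ?x) powr 2" using x by (simp add: power2_eq_square)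
  finally have "((1 + ?m) * (1 + ?n)) powr (3/2) \<le> ((2 * ?x) powr 2) powr (3/2)"
    by (intro powr_mono2) auto
  also have "\<dots> = (2 * ?x) powr 3" by (subst powr_powr) simp
  also have "\<dots> = (2 * ?x) ^ 3" using x by (subst powr_numeral) auto
  finally have "inverse ((2 * ?x) ^ 3) \<le> inverse (((1 + ?m) * (1 + ?n)) powr (3/2))"
    by (intro le_imp_inverse_le) auto
  also have "\<dots> = lattice_weight p" unfolding lattice_weight_def by (simp add: powr_minus)
  finally show "1 / norm ?w ^ 3 \<le> 8 * ?C ^ 3 * lattice_weight p"
    using w C by (simp add: field_simps)
qed

text \<open>An injection carries the filter of finite subsets of A to that of its image, so both
  sides are the same \<open>Lim\<close> expression, convergent or not. It serves both to rescale a
  lattice and to index it by pairs of integers.\<close>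

lemma Lim_prod_image:
  fixes h :: "'b \<Rightarrow> complex"
  assumes "inj g"
  shows "Lim (finite_subsets_at_top (g ` A)) (\<lambda>F. \<Prod>x\<in>F. h x) =
         Lim (finite_subsets_at_top A) (\<lambda>F. \<Prod>x\<in>F. h (g x))"
proof -
  have "filtermap ((`) g) (finite_subsets_at_top A) = finite_subsets_at_top (g ` A)"
    by (rule filtermap_image_finite_subsets_at_top) (meson assms inj_on_subset subset_UNIV)
  moreover have "(\<Prod>x\<in>g ` F. h x) = (\<Prod>x\<in>F. h (g x))" for F
    using assms by (subst prod.reindex) (auto simp: inj_on_def)
  ultimately show ?thesis
    by (simp add: Topological_Spaces.Lim_def filterlim_filtermap flip: \<open>filtermap _ _ = _\<close>)
qed

text \<open>Each factor depends only on the ratio of z and \<omega>, which scaling leaves alone; c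
  survives only in the leading z.\<close>

lemma weierstrass_sigma_scale:
  assumes "c \<noteq> 0"
  shows "weierstrass_sigma (c * z) ((*) c ` L) = c * weierstrass_sigma z L"
proof -
  have "(*) c ` L - {0} = (*) c ` (L - {0})" using assms by auto
  moreover have "inj ((*) c)" using assms by (auto simp: inj_on_def)
  ultimately show ?thesis
    using assms unfolding weierstrass_sigma_def by (simp add: Lim_prod_image)
qed

text \<open>Weierstrass's elementary factor of genus 2: the exponential cancels the linear and
  quadratic terms of log(1 - u), leaving 1 + O(u^3).\<close>

definition sigma_factor :: "complex \<Rightarrow> complex" where
  "sigma_factor u = (1 - u) * exp (u + u\<^sup>2 / 2)"

lemma weierstrass_sigma_lattice_pt:
  assumes "Im \<tau> > 0"
  shows "weierstrass_sigma z (period_lattice \<tau> 1) =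
    z * Lim (finite_subsets_at_top nonzero_pts) (\<lambda>F. \<Prod>p\<in>F. sigma_factor (z / lattice_pt \<tau> p))"
  unfolding weierstrass_sigma_def period_lattice_minus_0[OF assms] sigma_factor_def
  by (subst Lim_prod_image[OF inj_lattice_pt[OF assms]]) simp

text \<open>For |u| \<le> 1/2 this is the standard bound for elementary factors. For 1/2 < |u| \<le>
  B a crude bound suffices, since then 1 \<le> 8 |u|^3. One cubic estimate for all |u| \<le> B
  avoids splitting off the finitely many lattice points close to the origin.\<close>

lemma norm_sigma_factor_minus_1_le:
  assumes "norm u \<le> B"
  shows "norm (sigma_factor u - 1) \<le> (3 + 8 * ((1 + B) * exp (B + B\<^sup>2 / 2) + 1)) * norm u ^ 3"
proof (cases "norm u \<le> 1/2")
  case True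
  have "sigma_factor u = weierstrass_factor 2 u"
    by (simp add: sigma_factor_def weierstrass_factor_def numeral_2_eq_2)
  then have "norm (sigma_factor u - 1) \<le> 3 * norm u ^ 3"
    using weierstrass_factor_bound[OF True, of 2] by (simp add: numeral_3_eq_3)
  also have "\<dots> \<le> (3 + 8 * ((1 + B) * exp (B + B\<^sup>2 / 2) + 1)) * norm u ^ 3"
    using order_trans[OF norm_ge_zero assms] by (intro mult_right_mono) auto
  finally show ?thesis .
next
  case False
  let ?E = "(1 + B) * exp (B + B\<^sup>2 / 2) + 1"
  have B: "B \<ge> 0" using assms norm_ge_zero[of u] by linarith
  have "norm (u + u\<^sup>2 / 2) \<le> norm u + norm u ^ 2 / 2"
    by (rule order_trans[OF norm_triangle_ineq]) (simp add: norm_divide norm_power)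
  also have "\<dots> \<le> B + B\<^sup>2 / 2" using assms by (intro add_mono divide_right_mono power_mono) auto
  finally have "norm (exp (u + u\<^sup>2 / 2)) \<le> exp (B + B\<^sup>2 / 2)"
    using norm_exp[of "u + u\<^sup>2 / 2"] by (meson exp_le_cancel_iff order_trans)
  moreover have "norm (1 - u) \<le> 1 + B"
    using norm_triangle_ineq4[of 1 u] assms by simp
  ultimately have "norm (sigma_factor u) \<le> (1 + B) * exp (B + B\<^sup>2 / 2)"
    unfolding sigma_factor_def norm_mult using B by (intro mult_mono) auto
  then have "norm (sigma_factor u - 1) \<le> ?E"
    using norm_triangle_ineq4[of "sigma_factor u" 1] by simp
  also have "\<dots> = 8 * ?E * (1/2) ^ 3" by (simp add: power3_eq_cube)
  also have "\<dots> \<le> 8 * ?E * norm u ^ 3"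
    using False B by (intro mult_left_mono power_mono) auto
  also have "\<dots> \<le> (3 + 8 * ?E) * norm u ^ 3" by (intro mult_right_mono) auto
  finally show ?thesis .
qed

section \<open>Locally uniform convergence of the lattice product, and holomorphy of
  \<sigma>\<close>

definition sigma_prod :: "complex \<Rightarrow> complex \<Rightarrow> (int \<times> int) set \<Rightarrow> complex" where
  "sigma_prod \<tau> z F = (\<Prod>p\<in>F. sigma_factor (z / lattice_pt \<tau> p))"

lemma uniform_limit_sigma_prod:
  assumes y: "y > 0" and R: "R \<ge> 0"
  shows "uniform_limit ({\<tau>. y \<le> Im \<tau> \<and> norm \<tau> \<le> R} \<times> cball 0 R)
     (\<lambda>F (\<tau>, z). sigma_prod \<tau> z F)
     (\<lambda>(\<tau>, z). Lim (finite_subsets_at_top nonzero_pts) (sigma_prod \<tau> z))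
     (finite_subsets_at_top nonzero_pts)"
proof -
  define C where "C = lattice_const y R"
  \<comment> \<open>Bounds |z/\<omega>| for every nonzero \<omega>, because |z| \<le> R and
    1/|\<omega>| \<le> C.\<close>
  define B where "B = R * C"
  define K where "K = 3 + 8 * ((1 + B) * exp (B + B\<^sup>2 / 2) + 1)"
  have C: "C > 0" using lattice_const_pos y R by (auto simp: C_def)
  have B: "B \<ge> 0" using R C by (simp add: B_def)
  then have K: "K \<ge> 0" by (simp add: K_def)
  define w where "w = (\<lambda>p (\<tau>, z). sigma_factor (z / lattice_pt \<tau> p) - 1)"
  have bound: "norm (w p (\<tau>, z)) \<le> K * R ^ 3 * (8 * C ^ 3) * lattice_weight p"
    if p: "p \<noteq> 0" and \<tau>: "y \<le> Im \<tau>" "norm \<tau> \<le> R" and z: "norm z \<le> R" for p \<tau> z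
  proof -
    let ?l = "norm (lattice_pt \<tau> p)"
    have l: "1 \<le> C * ?l" using norm_lattice_pt_ge[OF y \<tau> p] by (simp add: C_def)
    then have l0: "?l > 0" by (cases "lattice_pt \<tau> p = 0") auto
    have "1 / ?l \<le> C" using l l0 by (simp add: field_simps)
    then have "norm z * (1 / ?l) \<le> R * C" using z R by (intro mult_mono) auto
    then have "norm (z / lattice_pt \<tau> p) \<le> B" by (simp add: norm_divide B_def)
    then have "norm (w p (\<tau>, z)) \<le> K * norm (z / lattice_pt \<tau> p) ^ 3"
      unfolding w_def K_def prod.case by (rule norm_sigma_factor_minus_1_le)
    also have "\<dots> = K * (norm z ^ 3 * (1 / ?l ^ 3))"
      by (simp add: norm_divide power_divide)
    also have "\<dots> \<le> K * (R ^ 3 * (8 * C ^ 3 * lattice_weight p))"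
      using inverse_norm_lattice_pt_cubed_le[OF y \<tau> p] z R K
      by (intro mult_mono power_mono) (auto simp: C_def)
    finally show ?thesis by (simp add: mult_ac)
  qed
  have "uniform_limit ({\<tau>. y \<le> Im \<tau> \<and> norm \<tau> \<le> R} \<times> cball 0 R)
     (\<lambda>F x. \<Prod>p\<in>F. 1 + w p x)
     (\<lambda>x. Lim (finite_subsets_at_top nonzero_pts) (\<lambda>F. \<Prod>p\<in>F. 1 + w p x))
     (finite_subsets_at_top nonzero_pts)"
    by (rule uniform_limit_unconditional_prod
          [where b = "\<lambda>p. K * R ^ 3 * (8 * C ^ 3) * lattice_weight p"])
       (auto intro!: summable_on_cmult_right summable_on_lattice_weight bound)
  moreover have "(\<lambda>F x. \<Prod>p\<in>F. 1 + w p x) = (\<lambda>F (\<tau>, z). sigma_prod \<tau> z F)"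
    by (auto simp: fun_eq_iff w_def sigma_prod_def)
  moreover have "(\<lambda>x. Lim (finite_subsets_at_top nonzero_pts) (\<lambda>F. \<Prod>p\<in>F. 1 + w p x)) =
     (\<lambda>(\<tau>, z). Lim (finite_subsets_at_top nonzero_pts) (sigma_prod \<tau> z))"
    by (auto simp: fun_eq_iff w_def sigma_prod_def[abs_def])
  ultimately show ?thesis by simp
qed

lemma tendsto_sigma_prod:
  assumes "Im \<tau> > 0"
  shows "(sigma_prod \<tau> z \<longlongrightarrow> Lim (finite_subsets_at_top nonzero_pts) (sigma_prod \<tau> z))
     (finite_subsets_at_top nonzero_pts)"
  using tendsto_uniform_limitI[OF uniform_limit_sigma_prod[of "Im \<tau>" "norm \<tau> + norm z"], of "(\<tau>, z)"]
    assms by auto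

text \<open>The finite products are jointly continuous and holomorphic in each variable separately;
  the locally uniform limit inherits both, which is the input of
  \<open>holomorphic2_onI\<close>.\<close>

lemma holomorphic2_on_weierstrass_sigma:
  "holomorphic2_on (\<lambda>\<tau> z. weierstrass_sigma z (period_lattice \<tau> 1)) (upper_half_plane \<times> UNIV)"
proof -
  let ?A = "finite_subsets_at_top nonzero_pts"
  define g where "g = (\<lambda>\<tau> z. Lim ?A (sigma_prod \<tau> z))"
  have sig: "weierstrass_sigma z (period_lattice \<tau> 1) = z * g \<tau> z" if "\<tau> \<in> upper_half_plane" for \<tau> z
    using that weierstrass_sigma_lattice_pt[of \<tau> z]
    by (simp add: g_def sigma_prod_def[abs_def] upper_half_plane_def)
  have oH: "open upper_half_plane"
    unfolding upper_half_plane_def by (intro open_Collect_less continuous_intros)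
  have nbhd: "uniform_limit (cball t0 (Im t0 / 2) \<times> cball z0 1) (\<lambda>F (\<tau>, z). sigma_prod \<tau> z F) (\<lambda>(\<tau>, z). g \<tau> z) ?A"
    and pos: "\<And>t. t \<in> cball t0 (Im t0 / 2) \<Longrightarrow> Im t > 0"
    if "t0 \<in> upper_half_plane" for t0 z0
  proof -
    have t0: "Im t0 > 0" using that by (simp add: upper_half_plane_def)
    have Im: "Im t \<ge> Im t0 / 2" if "t \<in> cball t0 (Im t0 / 2)" for t
      using that abs_Im_le_cmod[of "t0 - t"] by (simp add: dist_norm)
    then show "\<And>t. t \<in> cball t0 (Im t0 / 2) \<Longrightarrow> Im t > 0" using t0 by fastforce
    \<comment> \<open>Large enough to bound |t| and |z| on the closed neighbourhood of (t0, z0),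
      whose radii are Im t0 / 2 and 1.\<close>
    let ?R = "norm t0 + norm z0 + Im t0 + 1"
    have "cball t0 (Im t0 / 2) \<times> cball z0 1 \<subseteq> {\<tau>. Im t0 / 2 \<le> Im \<tau> \<and> norm \<tau> \<le> ?R} \<times> cball 0 ?R"
    proof safe
      fix t z assume t: "t \<in> cball t0 (Im t0 / 2)" and z: "z \<in> cball z0 1"
      show "Im t0 / 2 \<le> Im t" using Im t by auto
      have "norm (t - t0) \<le> Im t0 / 2" "norm (z - z0) \<le> 1"
        using t z by (simp_all add: dist_norm norm_minus_commute)
      then have "norm t \<le> ?R" "norm z \<le> ?R"
        using t0 norm_triangle_ineq2[of t t0] norm_ge_zero[of z0]
          norm_triangle_ineq2[of z z0] norm_ge_zero[of t0] by linarith+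
      then show "norm t \<le> ?R" "z \<in> cball 0 ?R" by simp_all
    qed
    then show "uniform_limit (cball t0 (Im t0 / 2) \<times> cball z0 1) (\<lambda>F (\<tau>, z). sigma_prod \<tau> z F) (\<lambda>(\<tau>, z). g \<tau> z) ?A"
      unfolding g_def using t0
      by (intro uniform_limit_on_subset[OF uniform_limit_sigma_prod[of "Im t0 / 2" ?R]])
         (auto intro!: add_nonneg_nonneg)
  qed
  have ev: "\<forall>\<^sub>F F in ?A. F \<subseteq> nonzero_pts" by (rule eventually_finite_subsets_at_top_weakI)
  have nz: "lattice_pt \<tau> p \<noteq> 0" if "Im \<tau> > 0" "p \<in> F" "F \<subseteq> nonzero_pts" for \<tau> p F
    using lattice_pt_eq_0_iff[OF that(1), of p] that by auto
  have contF: "continuous_on X (\<lambda>(\<tau>, z). sigma_prod \<tau> z F)"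
    if "F \<subseteq> nonzero_pts" "\<And>x. x \<in> X \<Longrightarrow> Im (fst x) > 0" for F X
    unfolding sigma_prod_def sigma_factor_def lattice_pt_def case_prod_beta
    using nz[OF that(2) _ that(1)] by (auto intro!: continuous_intros simp: lattice_pt_def)
  have holFz: "(\<lambda>z. sigma_prod \<tau> z F) holomorphic_on X" if "F \<subseteq> nonzero_pts" "Im \<tau> > 0" for F X \<tau>
    unfolding sigma_prod_def sigma_factor_def lattice_pt_def
    using nz[OF that(2) _ that(1)] by (auto intro!: holomorphic_intros simp: lattice_pt_def)
  have holFt: "(\<lambda>\<tau>. sigma_prod \<tau> z F) holomorphic_on X"
    if "F \<subseteq> nonzero_pts" "\<And>x. x \<in> X \<Longrightarrow> Im x > 0" for F X z
    unfolding sigma_prod_def sigma_factor_def lattice_pt_def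
    using nz[OF that(2) _ that(1)] by (auto intro!: holomorphic_intros simp: lattice_pt_def)
  have "holomorphic2_on (\<lambda>\<tau> z. z * g \<tau> z) (upper_half_plane \<times> UNIV)"
  proof (rule holomorphic2_onI[OF oH open_UNIV])
    have "isCont (\<lambda>(\<tau>, z). g \<tau> z) (t0, z0)" if t0: "t0 \<in> upper_half_plane" for t0 z0
    proof -
      let ?K = "cball t0 (Im t0 / 2) \<times> cball z0 1"
      have "continuous_on ?K (\<lambda>(\<tau>, z). g \<tau> z)"
        by (rule uniform_limit_theorem[OF _ nbhd[OF t0]])
           (use ev pos[OF t0] in \<open>auto elim!: eventually_mono intro!: contF\<close>)
      moreover have "(t0, z0) \<in> interior ?K"
        using t0 by (simp add: interior_Times upper_half_plane_def)
      ultimately show ?thesis by (rule continuous_on_interior)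
    qed
    then have "continuous_on (upper_half_plane \<times> UNIV) (\<lambda>(\<tau>, z). g \<tau> z)"
      by (auto intro!: continuous_at_imp_continuous_on)
    then show "continuous_on (upper_half_plane \<times> UNIV) (\<lambda>(\<tau>, z). z * g \<tau> z)"
      unfolding case_prod_beta by (intro continuous_intros) auto
  next
    fix t0 assume t0: "t0 \<in> upper_half_plane"
    have "g t0 holomorphic_on ball z0 1" for z0
    proof (rule holomorphic_uniform_limit[where f = "\<lambda>F z. sigma_prod t0 z F" and g = "g t0" and z = z0 and r = 1 and F = ?A])
      show "uniform_limit (cball z0 1) (\<lambda>F z. sigma_prod t0 z F) (g t0) ?A"
        using nbhd[OF t0, of z0] t0 unfolding uniform_limit_iff
        by (auto elim!: eventually_mono simp: upper_half_plane_def)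
      show "\<forall>\<^sub>F F in ?A. continuous_on (cball z0 1) (\<lambda>z. sigma_prod t0 z F) \<and>
              (\<lambda>z. sigma_prod t0 z F) holomorphic_on ball z0 1"
        using ev by eventually_elim
          (use t0 in \<open>auto intro!: holFz holomorphic_on_imp_continuous_on simp: upper_half_plane_def\<close>)
    qed auto
    then have "g t0 holomorphic_on UNIV"
      by (meson UNIV_I analytic_on_def analytic_imp_holomorphic zero_less_one)
    then show "(\<lambda>z. z * g t0 z) holomorphic_on UNIV" by (intro holomorphic_intros)
  next
    fix z0
    have "(\<lambda>\<tau>. g \<tau> z0) holomorphic_on ball t0 (Im t0 / 2)" if t0: "t0 \<in> upper_half_plane" for t0
    proof (rule holomorphic_uniform_limit[where f = "\<lambda>F \<tau>. sigma_prod \<tau> z0 F" and g = "\<lambda>\<tau>. g \<tau> z0" and z = t0 and r = "Im t0 / 2" and F = ?A])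
      show "uniform_limit (cball t0 (Im t0 / 2)) (\<lambda>F \<tau>. sigma_prod \<tau> z0 F) (\<lambda>\<tau>. g \<tau> z0) ?A"
        using nbhd[OF t0, of z0] unfolding uniform_limit_iff
        by (auto elim!: eventually_mono)
      show "\<forall>\<^sub>F F in ?A. continuous_on (cball t0 (Im t0 / 2)) (\<lambda>\<tau>. sigma_prod \<tau> z0 F) \<and>
              (\<lambda>\<tau>. sigma_prod \<tau> z0 F) holomorphic_on ball t0 (Im t0 / 2)"
        using ev by eventually_elim
          (use pos[OF t0] in \<open>auto intro!: holFt holomorphic_on_imp_continuous_on\<close>)
    qed auto
    then have "(\<lambda>\<tau>. g \<tau> z0) holomorphic_on upper_half_plane"
      unfolding upper_half_plane_def
      by (metis (mono_tags, lifting) analytic_on_def analytic_imp_holomorphic half_gt_zero mem_Collect_eq)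
    then show "(\<lambda>\<tau>. z0 * g \<tau> z0) holomorphic_on upper_half_plane" by (intro holomorphic_intros)
  qed
  \<comment> \<open>The product formula is available only over the upper half-plane; openness of
    that set lets derivatives pass from z * g to \<sigma>.\<close>
  moreover have "((\<lambda>(\<tau>, z). weierstrass_sigma z (period_lattice \<tau> 1)) has_derivative D) (at p)"
    if "((\<lambda>(\<tau>, z). z * g \<tau> z) has_derivative D) (at p)" "p \<in> upper_half_plane \<times> UNIV" for D p
    by (rule has_derivative_transform_within_open[OF that(1) open_Times[OF oH open_UNIV] that(2)])
       (auto simp: sig)
  ultimately show ?thesis
    unfolding holomorphic2_on_def by meson
qed

text \<open>With j = c\<tau> + d and t the image of \<tau>, the lattice [\<tau>, 1] is j times
  [t, 1]. Homogeneity at z/j then produces the factor j, which is the weight factor for k =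
  -1.\<close>

lemma slash_mod_weierstrass_sigma:
  assumes M: "M \<in> SL2Z" and \<tau>: "Im \<tau> > 0"
  shows "slash_mod (-1) M (\<lambda>\<tau> z. weierstrass_sigma z (period_lattice \<tau> 1)) \<tau> z =
         weierstrass_sigma z (period_lattice \<tau> 1)"
proof -
  define a b c d where "a = M $ 1 $ 1" and "b = M $ 1 $ 2" and "c = M $ 2 $ 1" and "d = M $ 2 $ 2"
  have det: "a * d - b * c = 1" using M by (simp add: SL2Z_def det_2 a_def b_def c_def d_def)
  let ?j = "of_int c * \<tau> + of_int d :: complex"
  have "(c, d) \<noteq> 0" using det by (auto simp: zero_prod_def)
  then have j: "?j \<noteq> 0" using lattice_pt_eq_0_iff[OF \<tau>, of "(c, d)"] by (simp add: lattice_pt_def)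
  let ?t = "(of_int a * \<tau> + of_int b) / ?j"
  have jt: "?j * (of_int m * ?t + of_int n) = of_int m * (of_int a * \<tau> + of_int b) + of_int n * ?j"
    for m n :: int
  proof -
    have "x * (y * (w / x) + v) = y * w + v * x" if "x \<noteq> 0" for x y w v :: complex
      using that by (simp add: field_simps)
    from this[OF j] show ?thesis .
  qed
  have "period_lattice \<tau> 1 = (*) ?j ` period_lattice ?t 1"
  proof (rule Set.set_eqI, rule iffI)
    fix x assume "x \<in> period_lattice \<tau> 1"
    then obtain m n where x: "x = of_int m * \<tau> + of_int n" by (auto simp: period_lattice_def)
    \<comment> \<open>The row vector (m, n) times the inverse matrix gives the coordinates with
      respect to the basis (a\<tau> + b, c\<tau> + d).\<close>
    have 1: "(d * m - c * n) * a + (a * n - b * m) * c = m" "(d * m - c * n) * b + (a * n - b * m) * d = n"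
      using det by algebra+
    have "x = of_int ((d * m - c * n) * a + (a * n - b * m) * c) * \<tau> + of_int ((d * m - c * n) * b + (a * n - b * m) * d)"
      by (simp only: 1 x)
    also have "\<dots> = ?j * (of_int (d * m - c * n) * ?t + of_int (a * n - b * m))"
      unfolding jt by (simp add: algebra_simps)
    finally show "x \<in> (*) ?j ` period_lattice ?t 1" 
      unfolding period_lattice_def mult_1_right by (intro image_eqI) blast+
  next
    fix x assume "x \<in> (*) ?j ` period_lattice ?t 1"
    then obtain m n where "x = ?j * (of_int m * ?t + of_int n)" by (auto simp: period_lattice_def)
    then have "x = of_int (m * a + n * c) * \<tau> + of_int (m * b + n * d) * 1"
      unfolding jt by (simp add: algebra_simps)
    then show "x \<in> period_lattice \<tau> 1" unfolding period_lattice_def by blast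
  qed
  with weierstrass_sigma_scale[OF j, of "z / ?j" "period_lattice ?t 1"] j
  show ?thesis by (simp add: slash_mod_def a_def b_def c_def d_def Let_def)
qed

section \<open>Trigonometric limits\<close>

lemma atLeastAtMost_symmetric_Suc:
  "{- int (Suc N)..int (Suc N)} = insert (int (Suc N)) (insert (- int (Suc N)) {- int N..int N})"
  by auto

lemma prod_symmetric_int:
  fixes g :: "int \<Rightarrow> 'a :: comm_monoid_mult"
  shows "(\<Prod>n\<in>{- int N..int N}. g n) = g 0 * (\<Prod>k=1..N. g (int k) * g (- int k))"
proof (induction N)
  case (Suc N)
  show ?case unfolding atLeastAtMost_symmetric_Suc
    by (simp add: Suc.IH mult_ac del: of_nat_Suc)
qed simp

lemma prod_symmetric_int_nonzero:
  fixes g :: "int \<Rightarrow> 'a :: comm_monoid_mult"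
  shows "(\<Prod>n\<in>{- int N..int N} - {0}. g n) = (\<Prod>k=1..N. g (int k) * g (- int k))"
proof -
  have "(\<Prod>n\<in>{- int N..int N}. (g(0 := 1)) n) = (\<Prod>n\<in>{- int N..int N} - {0}. g n)"
    by (subst prod.remove[of _ 0]) (auto intro!: prod.cong)
  moreover have "(\<Prod>k=1..N. (g(0 := 1)) (int k) * (g(0 := 1)) (- int k)) = (\<Prod>k=1..N. g (int k) * g (- int k))"
    by (intro prod.cong) auto
  ultimately show ?thesis unfolding prod_symmetric_int by simp
qed

lemma sin_pi_mult_nonzero:
  fixes w :: complex assumes "w \<notin> \<int>"
  shows "sin (of_real pi * w) \<noteq> 0"
proof
  assume "sin (of_real pi * w) = 0"
  then obtain n :: int where "of_real pi * w = of_int n * of_real pi" by (auto simp: sin_eq_0)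
  then have "w = of_int n" by simp
  with assms show False by simp
qed

text \<open>Logarithmic derivative of the reflection formula for Gamma, obtained by differentiating
  both sides and cancelling the nonzero factor \<pi> / sin(\<pi>w).\<close>

lemma Digamma_reflection:
  fixes w :: complex assumes "w \<notin> \<int>"
  shows "Digamma (1 - w) - Digamma w = of_real pi * cot (of_real pi * w)"
proof -
  note s = sin_pi_mult_nonzero[OF assms]
  have w: "w \<notin> \<int>\<^sub>\<le>\<^sub>0" "1 - w \<notin> \<int>\<^sub>\<le>\<^sub>0"
    using assms by (auto dest!: nonpos_Ints_Int)
  let ?G = "Gamma w * Gamma (1 - w)"
  have "((\<lambda>z. Gamma z * Gamma (1 - z)) has_field_derivative (?G * (Digamma w - Digamma (1 - w)))) (at w)"
    using w by (auto intro!: derivative_eq_intros simp: algebra_simps)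
  moreover have "((\<lambda>z. of_real pi / sin (of_real pi * z)) has_field_derivative
      (- (of_real pi)\<^sup>2 * cos (of_real pi * w) / (sin (of_real pi * w))\<^sup>2)) (at w)"
    using s by (auto intro!: derivative_eq_intros simp: power2_eq_square)
  ultimately have "?G * (Digamma w - Digamma (1 - w)) = - (of_real pi)\<^sup>2 * cos (of_real pi * w) / (sin (of_real pi * w))\<^sup>2"
    unfolding Gamma_reflection_complex by (rule DERIV_unique)
  then have "(of_real pi / sin (of_real pi * w)) *
      ((Digamma w - Digamma (1 - w)) + of_real pi * (cos (of_real pi * w) / sin (of_real pi * w))) = 0"
    unfolding Gamma_reflection_complex by (simp add: distrib_left power2_eq_square)
  then have "(Digamma w - Digamma (1 - w)) + of_real pi * (cos (of_real pi * w) / sin (of_real pi * w)) = 0"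
    using s by simp
  then show ?thesis by (simp add: cot_def algebra_simps add_eq_0_iff2)
qed

text \<open>The terms with n \<le> 0 and those with n > 0 are the partial sums of Digamma at w and
  at 1 - w, so the reflection formula evaluates the limit.\<close>

lemma tendsto_sum_cot:
  fixes w :: complex assumes "w \<notin> \<int>"
  shows "(\<lambda>N. \<Sum>n\<in>{- int N..int N}. 1 / (w - of_int n)) \<longlonglongrightarrow> of_real pi * cot (of_real pi * w)"
proof -
  have w: "w + of_nat n \<noteq> 0" "1 - w + of_nat n \<noteq> 0" "w - 1 - of_nat n \<noteq> 0" for n
  proof -
    show "w + of_nat n \<noteq> 0" using assms by (metis Ints_minus Ints_of_nat add_eq_0_iff2)
    have "w \<noteq> of_nat (Suc n)" using assms by auto
    then show "1 - w + of_nat n \<noteq> 0" "w - 1 - of_nat n \<noteq> 0" by (auto simp: algebra_simps)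
  qed
  \<comment> \<open>There are N + 1 indices n \<le> 0 but only N indices n > 0; the surplus term n =
    -N stands alone and tends to 0.\<close>
  have eq: "(\<Sum>n\<in>{- int N..int N}. 1 / (w - of_int n)) =
     1 / (w + of_nat N) + ((\<Sum>n<N. inverse (w + of_nat n)) - (\<Sum>n<N. inverse (1 - w + of_nat n)))" for N
  proof (induction N)
    case (Suc N)
    have "1 / (w - 1 - of_nat N) = - inverse (1 - w + of_nat N)"
      using w[of N] by (simp add: field_simps)
    then show ?case unfolding atLeastAtMost_symmetric_Suc
      by (simp add: Suc.IH inverse_eq_divide algebra_simps)
  qed simp
  have "(\<lambda>N. inverse (w + of_nat N)) \<longlonglongrightarrow> 0"
    by (intro tendsto_inverse_0[THEN filterlim_compose] tendsto_add_filterlim_at_infinity[OF tendsto_const tendsto_of_nat])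
  then have 0: "(\<lambda>N. 1 / (w + of_nat N)) \<longlonglongrightarrow> 0" by (simp add: inverse_eq_divide)
  have "1 - w \<noteq> 0" "w \<noteq> 0" using assms by auto
  \<comment> \<open>The logarithms in the two limits cancel in the difference.\<close>
  from tendsto_diff[OF Digamma_LIMSEQ[OF this(1)] Digamma_LIMSEQ[OF this(2)]]
  have "(\<lambda>N. (\<Sum>n<N. inverse (w + of_nat n)) - (\<Sum>n<N. inverse (1 - w + of_nat n)))
     \<longlonglongrightarrow> Digamma (1 - w) - Digamma w"
    by (simp add: algebra_simps)
  from tendsto_add[OF 0 this] show ?thesis
    unfolding eq Digamma_reflection[OF assms] by simp
qed

lemma tendsto_prod_sin_nonzero:
  fixes z :: complex
  shows "(\<lambda>N. z * (\<Prod>n\<in>{- int N..int N} - {0}. 1 - z / of_int n)) \<longlonglongrightarrow> sin (of_real pi * z) / of_real pi"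
proof -
  have "(\<Prod>n\<in>{- int N..int N} - {0}. 1 - z / of_int n) = (\<Prod>k=1..N. 1 - z\<^sup>2 / of_nat k ^ 2)" for N
    unfolding prod_symmetric_int_nonzero by (intro prod.cong) (auto simp: field_simps power2_eq_square)
  with tendsto_divide[OF sin_product_formula_complex[of z] tendsto_const[of "of_real pi"]]
  show ?thesis by simp
qed

text \<open>Each factor is (w - z + n) / (w + n). Numerators and denominators are, up to the same
  nonzero factor, partial products of the sine product at w - z and at w.\<close>

lemma tendsto_prod_sin_quotient:
  fixes w z :: complex assumes "w \<notin> \<int>"
  shows "(\<lambda>N. \<Prod>n\<in>{- int N..int N}. 1 - z / (w + of_int n)) \<longlonglongrightarrow>
    sin (of_real pi * (w - z)) / sin (of_real pi * w)"
proof -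
  note s = sin_pi_mult_nonzero[OF assms]
  \<comment> \<open>The N-th partial product of sin(\<pi>x).\<close>
  define g where "g = (\<lambda>N x. of_real pi * x * (\<Prod>k=1..N. 1 - x\<^sup>2 / of_nat k ^ 2) :: complex)"
  have w: "w + of_int n \<noteq> 0" for n
    using assms by (metis Ints_minus Ints_of_int add_eq_0_iff2)
  have g: "g N x = of_real pi * (\<Prod>n\<in>{- int N..int N}. x + of_int n) * (\<Prod>k=1..N. - 1 / of_nat k ^ 2)" for N x
  proof -
    have "(\<Prod>k=1..N. 1 - x\<^sup>2 / of_nat k ^ 2) =
        (\<Prod>k=1..N. (x + of_int (int k)) * (x + of_int (- int k))) * (\<Prod>k=1..N. - 1 / of_nat k ^ 2)"
      unfolding prod.distrib[symmetric]
      by (intro prod.cong) (auto simp: field_simps power2_eq_square)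
    then show ?thesis unfolding g_def prod_symmetric_int by (simp add: mult_ac)
  qed
  have "(\<Prod>n\<in>{- int N..int N}. 1 - z / (w + of_int n)) = g N (w - z) / g N w" for N
  proof -
    have "(\<Prod>k=1..N. - 1 / of_nat k ^ 2 :: complex) \<noteq> 0" by (auto simp: prod_zero_iff)
    moreover have "(\<Prod>n\<in>{- int N..int N}. 1 - z / (w + of_int n)) =
        (\<Prod>n\<in>{- int N..int N}. w - z + of_int n) / (\<Prod>n\<in>{- int N..int N}. w + of_int n)"
      unfolding prod_dividef[symmetric] using w by (intro prod.cong) (auto simp: field_simps)
    ultimately show ?thesis unfolding g by simp
  qed
  moreover have "(\<lambda>N. g N (w - z) / g N w) \<longlonglongrightarrow> sin (of_real pi * (w - z)) / sin (of_real pi * w)"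
    unfolding g_def using s by (intro tendsto_divide sin_product_formula_complex)
  ultimately show ?thesis by simp
qed

lemma sin_pi_mult_eq: "sin (of_real pi * w) =
    (exp (\<i> * of_real pi * w) - exp (- (\<i> * of_real pi * w))) / (2 * \<i>)" for w :: complex
  by (simp add: sin_exp_eq mult_ac)

lemma tendsto_exp_nome_power:
  assumes "Im \<tau> > 0"
  shows "(\<lambda>M. exp (2 * of_real pi * \<i> * (of_nat M * \<tau>))) \<longlonglongrightarrow> 0"
proof -
  have "norm (exp (2 * of_real pi * \<i> * \<tau>)) < 1" using assms by simp
  then have "(\<lambda>M. exp (2 * of_real pi * \<i> * \<tau>) ^ M) \<longlonglongrightarrow> 0" by (rule LIMSEQ_power_zero)
  then show ?thesis by (simp add: mult_ac flip: exp_of_nat_mult)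
qed

text \<open>In terms of Q = e(x + M\<tau>) the cotangent is i(Q + 1)/(Q - 1), and Q tends to 0
  because M\<tau> moves up the half-plane.\<close>

lemma tendsto_cot_upper:
  fixes x \<tau> :: complex assumes "Im \<tau> > 0"
  shows "(\<lambda>M. cot (of_real pi * (x + of_nat M * \<tau>))) \<longlonglongrightarrow> - \<i>"
proof -
  let ?Q = "\<lambda>M. exp (2 * of_real pi * \<i> * x) * exp (2 * of_real pi * \<i> * (of_nat M * \<tau>))"
  have "cot (of_real pi * (x + of_nat M * \<tau>)) = \<i> * ((?Q M + 1) / (?Q M - 1))" for M
  proof -
    let ?w = "of_real pi * (x + of_nat M * \<tau>)"
    let ?e = "exp (\<i> * ?w)"
    have Q: "?Q M = ?e * ?e" by (simp add: algebra_simps flip: exp_add)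
    have "cot ?w = (\<i> * (?e + exp (- (\<i> * ?w)))) / (?e - exp (- (\<i> * ?w)))"
    proof -
      \<comment> \<open>For a = b, the poles of the cotangent, both sides are 0 by the convention
        for division, so the identity holds for every x and M.\<close>
      have "((a + b) / 2) / ((a - b) / (2 * \<i>)) = (\<i> * (a + b)) / (a - b)" for a b :: complex
        by (cases "a = b") (simp_all add: field_simps)
      then show ?thesis unfolding cot_def sin_exp_eq cos_exp_eq .
    qed
    also have "\<dots> = (?e * (\<i> * (?e + exp (- (\<i> * ?w))))) / (?e * (?e - exp (- (\<i> * ?w))))"
      by (rule mult_divide_mult_cancel_left[symmetric]) simp
    also have "\<dots> = \<i> * ((?Q M + 1) / (?Q M - 1))"
      unfolding Q by (simp add: algebra_simps flip: exp_add)
    finally show ?thesis .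
  qed
  moreover have "(\<lambda>M. \<i> * ((?Q M + 1) / (?Q M - 1))) \<longlonglongrightarrow>
      \<i> * ((exp (2 * of_real pi * \<i> * x) * 0 + 1) / (exp (2 * of_real pi * \<i> * x) * 0 - 1))"
    by (intro tendsto_intros tendsto_exp_nome_power assms) auto
  ultimately show ?thesis by simp
qed

section \<open>Summation over boxes\<close>

definition box_pts :: "nat \<Rightarrow> nat \<Rightarrow> (int \<times> int) set" where
  "box_pts M N = {- int M..int M} \<times> {- int N..int N}"

lemma finite_box_pts [simp]: "finite (box_pts M N)" by (simp add: box_pts_def)

lemma zero_in_box_pts [simp]: "0 \<in> box_pts M N" by (simp add: box_pts_def zero_prod_def)

lemma box_pts_cover: "\<exists>k. \<forall>M\<ge>k. \<forall>N\<ge>k. p \<in> box_pts M N"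
  by (rule exI[of _ "max (nat \<bar>fst p\<bar>) (nat \<bar>snd p\<bar>)"]) (cases p; auto simp: box_pts_def)

lemma sum_box_pts: "(\<Sum>p\<in>box_pts M N. f p) = (\<Sum>m\<in>{- int M..int M}. \<Sum>n\<in>{- int N..int N}. f (m, n))"
  by (simp add: box_pts_def sum.cartesian_product)

lemma prod_Times: "(\<Prod>p\<in>A \<times> B. f p) = (\<Prod>m\<in>A. \<Prod>n\<in>B. f (m, n))"
  by (simp add: prod.cartesian_product)

lemma iterated_limit_box_pts:
  fixes S :: "'a :: metric_space"
  assumes "(P \<longlongrightarrow> S) (finite_subsets_at_top nonzero_pts)"
    and "\<And>M. (\<lambda>N. P (box_pts M N - {0})) \<longlonglongrightarrow> R M"
  shows "R \<longlonglongrightarrow> S"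
  using box_pts_cover
  by (intro iterated_limit_of_unconditional[where B = "\<lambda>M N. box_pts M N - {0}", OF assms(1) _ _ _ assms(2)]) auto

text \<open>The boxes are symmetric about the origin. This removes the terms 1/\<omega> from zeta
  and z/\<omega> from the exponents of \<sigma> at every finite stage.\<close>

lemma sum_box_pts_odd:
  fixes f :: "int \<times> int \<Rightarrow> complex"
  assumes "\<And>p. f (- p) = - f p"
  shows "(\<Sum>p\<in>box_pts M N. f p) = 0"
proof -
  have "(\<Sum>p\<in>box_pts M N. f p) = (\<Sum>p\<in>box_pts M N. f (- p))"
    by (rule sum.reindex_bij_witness[of _ uminus uminus]) (auto simp: box_pts_def)
  then show ?thesis using assms by (simp add: sum_negf)
qed

lemma sum_box_pts_minus_0:
  assumes "f 0 = 0" shows "(\<Sum>p\<in>box_pts M N - {0}. f p) = (\<Sum>p\<in>box_pts M N. f p :: complex)"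
  using assms by (simp add: sum_diff1)

lemma filterlim_symmetric_int: "filterlim (\<lambda>N. {- int N..int N}) (finite_subsets_at_top UNIV) sequentially"
  unfolding filterlim_finite_subsets_at_top
proof safe
  fix X :: "int set" assume "finite X"
  then have k: "\<bar>x\<bar> \<le> Max (abs ` X)" if "x \<in> X" for x using that by simp
  show "\<forall>\<^sub>F N in sequentially. finite {- int N..int N} \<and> X \<subseteq> {- int N..int N} \<and> {- int N..int N} \<subseteq> UNIV"
    using eventually_ge_at_top[of "nat (Max (abs ` X))"] by eventually_elim (use k in fastforce)
qed

text \<open>Only the inner limit, over n, is taken here; it is genuine because each single row
  converges absolutely. The outer limit over M is handled separately, as absolute convergence fails
  there.\<close>

definition eisenstein2_partial :: "complex \<Rightarrow> nat \<Rightarrow> complex" where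
  "eisenstein2_partial \<tau> M = lim (\<lambda>N. \<Sum>p\<in>box_pts M N. 1 / (lattice_pt \<tau> p)\<^sup>2)"

context
  fixes \<tau> :: complex
  assumes \<tau>: "Im \<tau> > 0"
begin

text \<open>The term at the origin is harmless because of \<open>1 / 0 = 0\<close>.\<close>

lemma tendsto_eisenstein2_partial:
  "(\<lambda>N. \<Sum>p\<in>box_pts M N. 1 / (lattice_pt \<tau> p)\<^sup>2) \<longlonglongrightarrow> eisenstein2_partial \<tau> M"
proof -
  define C where "C = lattice_const (Im \<tau>) (norm \<tau>)"
  have "convergent (\<lambda>N. \<Sum>n\<in>{- int N..int N}. 1 / (lattice_pt \<tau> (m, n))\<^sup>2)" for m
  proof -
    have "(\<lambda>n. norm (1 / (lattice_pt \<tau> (m, n))\<^sup>2)) summable_on UNIV"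
    proof (rule Infinite_Sum.abs_summable_on_comparison_test')
      show "(\<lambda>n. 4 * C\<^sup>2 * (1 + \<bar>real_of_int n\<bar>) powr (-3/2)) summable_on UNIV"
        by (intro summable_on_cmult_right summable_on_int_powr)
      fix n
      show "norm (1 / (lattice_pt \<tau> (m, n))\<^sup>2) \<le> 4 * C\<^sup>2 * (1 + \<bar>real_of_int n\<bar>) powr (-3/2)"
      proof (cases "(m, n) = 0")
        case True
        then show ?thesis by (simp add: lattice_pt_def zero_prod_def)
      next
        case False
        let ?l = "norm (lattice_pt \<tau> (m, n))"
        have 1: "1 \<le> C * ?l" using norm_lattice_pt_ge[OF \<tau> order_refl order_refl False] by (simp add: C_def)
        then have l: "?l > 0" by (cases "lattice_pt \<tau> (m, n) = 0") auto
        have "\<bar>real_of_int n\<bar> \<le> C * ?l"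
          using lattice_coeff_le_norm(2)[OF \<tau> order_refl order_refl, of "(m, n)"] by (simp add: C_def)
        with 1 have "1 + \<bar>real_of_int n\<bar> \<le> 2 * (C * ?l)" by simp
        then have "(1 + \<bar>real_of_int n\<bar>)\<^sup>2 \<le> (2 * (C * ?l))\<^sup>2" by (intro power_mono) auto
        then have "1 / ?l\<^sup>2 \<le> 4 * C\<^sup>2 * (1 / (1 + \<bar>real_of_int n\<bar>)\<^sup>2)"
          using l by (simp add: field_simps)
        also have "1 / (1 + \<bar>real_of_int n\<bar>)\<^sup>2 = (1 + \<bar>real_of_int n\<bar>) powr (-2)"
          by (simp add: powr_minus powr_numeral inverse_eq_divide)
        \<comment> \<open>The exponent is weakened from -2 to -3/2 to meet the summability result
          proved for the lattice weight.\<close>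
        also have "\<dots> \<le> (1 + \<bar>real_of_int n\<bar>) powr (-3/2)" by (intro powr_mono) auto
        finally show ?thesis by (simp add: norm_divide norm_power mult_left_mono)
      qed
    qed
    then have "(\<lambda>n. 1 / (lattice_pt \<tau> (m, n))\<^sup>2) summable_on UNIV"
      by (rule Infinite_Sum.abs_summable_summable)
    from has_sum_infsum[OF this, unfolded has_sum_def]
    have "(\<lambda>N. \<Sum>n\<in>{- int N..int N}. 1 / (lattice_pt \<tau> (m, n))\<^sup>2) \<longlonglongrightarrow>
        (\<Sum>\<^sub>\<infinity>n. 1 / (lattice_pt \<tau> (m, n))\<^sup>2)"
      by (rule filterlim_compose[OF _ filterlim_symmetric_int])
    then show ?thesis by (rule convergentI)
  qed
  then have "convergent (\<lambda>N. \<Sum>p\<in>box_pts M N. 1 / (lattice_pt \<tau> p)\<^sup>2)"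
    unfolding sum_box_pts by (intro convergent_sum) auto
  then show ?thesis unfolding eisenstein2_partial_def by (simp add: convergent_LIMSEQ_iff)
qed

section \<open>Zeta and \<sigma> as limits of row sums and row products\<close>

lemma sum_box_pts_inverse: "(\<Sum>p\<in>box_pts M N. 1 / lattice_pt \<tau> p) = 0"
  by (rule sum_box_pts_odd) (metis divide_minus_right lattice_pt_minus)

lemma not_Ints_row: "m \<noteq> 0 \<Longrightarrow> of_int m * \<tau> \<notin> \<int>"
  using \<tau> by (auto elim!: Ints_cases simp: complex_eq_iff)

lemma not_Ints_row':
  assumes "z \<notin> period_lattice \<tau> 1" shows "z - of_int m * \<tau> \<notin> \<int>"
proof
  assume "z - of_int m * \<tau> \<in> \<int>"
  then obtain n where "z = of_int m * \<tau> + of_int n * 1"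
    by (auto elim!: Ints_cases simp: algebra_simps)
  with assms show False unfolding period_lattice_def by blast
qed

text \<open>Over a common denominator the term is z^2 / (\<omega>^2 (z - \<omega>)), which is
  O(|\<omega>|^(-3)) once |\<omega>| > 2|z|. The finitely many remaining points are enclosed in the
  box X.\<close>

lemma zeta_terms_summable:
  assumes z: "z \<notin> period_lattice \<tau> 1"
  shows "(\<lambda>p. 1 / (z - lattice_pt \<tau> p) + 1 / lattice_pt \<tau> p + z / (lattice_pt \<tau> p)\<^sup>2) summable_on nonzero_pts"
    (is "?f summable_on _")
proof -
  define C where "C = lattice_const (Im \<tau>) (norm \<tau>)"
  have C: "C > 0" using lattice_const_pos \<tau> by (auto simp: C_def)
  \<comment> \<open>If |\<omega>| \<le> 2|z|, both coordinates of \<omega> are at most 2C|z| in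
    absolute value, so \<omega> lies in X.\<close>
  define k where "k = \<lceil>C * (2 * norm z)\<rceil>"
  define X where "X = {-k..k} \<times> {-k..k}"
  have 1: "?f summable_on nonzero_pts \<inter> X" by (rule summable_on_finite) (auto simp: X_def)
  have 2: "?f summable_on nonzero_pts - X"
  proof (rule Infinite_Sum.abs_summable_summable, rule Infinite_Sum.abs_summable_on_comparison_test')
    show "(\<lambda>p. 2 * norm z ^ 2 * (8 * C ^ 3) * lattice_weight p) summable_on nonzero_pts - X"
      by (intro summable_on_cmult_right summable_on_lattice_weight)
    fix p assume p: "p \<in> nonzero_pts - X"
    let ?w = "lattice_pt \<tau> p"
    have w0: "?w \<noteq> 0" using lattice_pt_eq_0_iff[OF \<tau>, of p] p by auto
    have zw: "z - ?w \<noteq> 0" using z by (auto simp: period_lattice_eq_range)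
    have "2 * norm z < norm ?w"
    proof (rule ccontr)
      assume "\<not> ?thesis"
      then have "C * norm ?w \<le> C * (2 * norm z)" using C by (intro mult_left_mono) auto
      with lattice_coeff_le_norm[OF \<tau> order_refl order_refl, of p]
      have "\<bar>real_of_int (fst p)\<bar> \<le> C * (2 * norm z)" "\<bar>real_of_int (snd p)\<bar> \<le> C * (2 * norm z)"
        unfolding C_def by linarith+
      then have "\<bar>fst p\<bar> \<le> k" "\<bar>snd p\<bar> \<le> k" unfolding k_def by linarith+
      then have "p \<in> X" by (cases p) (auto simp: X_def)
      with p show False by auto
    qed
    then have far: "norm ?w / 2 \<le> norm (z - ?w)"
      using norm_triangle_ineq2[of ?w z] by (simp add: norm_minus_commute)
    have "?f p = z\<^sup>2 / (?w\<^sup>2 * (z - ?w))"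
      using w0 zw by (simp add: divide_simps) (simp add: algebra_simps power2_eq_square)
    then have "norm (?f p) = norm z ^ 2 * (1 / (norm ?w ^ 2 * norm (z - ?w)))"
      by (simp add: norm_divide norm_mult norm_power)
    also have "\<dots> \<le> norm z ^ 2 * (1 / (norm ?w ^ 2 * (norm ?w / 2)))"
      using far w0 zw by (intro mult_left_mono divide_left_mono) (auto intro!: mult_pos_pos)
    also have "\<dots> = 2 * norm z ^ 2 * (1 / norm ?w ^ 3)" by (simp add: power2_eq_square power3_eq_cube)
    also have "\<dots> \<le> 2 * norm z ^ 2 * (8 * C ^ 3 * lattice_weight p)"
      using inverse_norm_lattice_pt_cubed_le[OF \<tau> order_refl order_refl, of p] p
      by (intro mult_left_mono) (auto simp: C_def)
    finally show "norm (?f p) \<le> 2 * norm z ^ 2 * (8 * C ^ 3) * lattice_weight p" by (simp add: mult_ac)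
  qed
  have "?f summable_on (nonzero_pts \<inter> X) \<union> (nonzero_pts - X)"
    using 1 2 by (rule summable_on_Un_disjoint) auto
  then show ?thesis by (simp add: Int_Diff_Un)
qed

text \<open>On a box the odd terms cancel, the terms z/\<omega>^2 collect to z times the partial
  Eisenstein sum, and what remains of row m is the partial fraction expansion of a cotangent at z -
  m\<tau>.\<close>

lemma weierstrass_zeta_limit:
  assumes z: "z \<notin> period_lattice \<tau> 1"
  shows "(\<lambda>M. (\<Sum>m\<in>{- int M..int M}. of_real pi * cot (of_real pi * (z - of_int m * \<tau>)))
           + z * eisenstein2_partial \<tau> M) \<longlonglongrightarrow> weierstrass_zeta z (period_lattice \<tau> 1)"
proof -
  let ?f = "\<lambda>w. 1 / (z - w) + 1 / w + z / w\<^sup>2"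
  have "weierstrass_zeta z (period_lattice \<tau> 1) = 1 / z + (\<Sum>\<^sub>\<infinity>p\<in>nonzero_pts. ?f (lattice_pt \<tau> p))"
    unfolding weierstrass_zeta_def period_lattice_minus_0[OF \<tau>]
    by (subst infsum_reindex) (auto intro: inj_on_subset[OF inj_lattice_pt[OF \<tau>]] simp: o_def)
  moreover have "((\<lambda>F. 1 / z + sum (\<lambda>p. ?f (lattice_pt \<tau> p)) F) \<longlongrightarrow>
      1 / z + (\<Sum>\<^sub>\<infinity>p\<in>nonzero_pts. ?f (lattice_pt \<tau> p))) (finite_subsets_at_top nonzero_pts)"
    using has_sum_infsum[OF zeta_terms_summable[OF z]] unfolding has_sum_def by (intro tendsto_intros)
  moreover have "(\<lambda>N. 1 / z + sum (\<lambda>p. ?f (lattice_pt \<tau> p)) (box_pts M N - {0})) \<longlonglongrightarrow>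
      (\<Sum>m\<in>{- int M..int M}. of_real pi * cot (of_real pi * (z - of_int m * \<tau>))) + z * eisenstein2_partial \<tau> M" for M
  proof -
    have "1 / z + sum (\<lambda>p. ?f (lattice_pt \<tau> p)) (box_pts M N - {0}) =
      (\<Sum>m\<in>{- int M..int M}. \<Sum>n\<in>{- int N..int N}. 1 / (z - of_int m * \<tau> - of_int n))
        + z * (\<Sum>p\<in>box_pts M N. 1 / (lattice_pt \<tau> p)\<^sup>2)" for N
    proof -
      \<comment> \<open>The isolated 1/z is the missing origin term, which completes row 0.\<close>
      have "1 / z + (\<Sum>p\<in>box_pts M N - {0}. 1 / (z - lattice_pt \<tau> p)) = (\<Sum>p\<in>box_pts M N. 1 / (z - lattice_pt \<tau> p))"
        by (simp add: sum.remove[of _ 0])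
      moreover have "(\<Sum>p\<in>box_pts M N - {0}. 1 / lattice_pt \<tau> p) = 0"
        using sum_box_pts_inverse by (subst sum_box_pts_minus_0) auto
      moreover have "(\<Sum>p\<in>box_pts M N - {0}. z / (lattice_pt \<tau> p)\<^sup>2) = z * (\<Sum>p\<in>box_pts M N. 1 / (lattice_pt \<tau> p)\<^sup>2)"
        by (subst sum_box_pts_minus_0) (auto simp: sum_distrib_left)
      moreover have "(\<Sum>p\<in>box_pts M N. 1 / (z - lattice_pt \<tau> p)) =
          (\<Sum>m\<in>{- int M..int M}. \<Sum>n\<in>{- int N..int N}. 1 / (z - of_int m * \<tau> - of_int n))"
        unfolding sum_box_pts by (simp add: lattice_pt_def diff_diff_eq)
      ultimately show ?thesis by (simp add: sum.distrib flip: add.assoc)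
    qed
    then show ?thesis
      by (simp only:) (intro tendsto_intros tendsto_sum_cot not_Ints_row'[OF z] tendsto_eisenstein2_partial)
  qed
  ultimately show ?thesis by (simp only: iterated_limit_box_pts)
qed

text \<open>On a box the exponential factors multiply to exp(z^2/2 times the sum of 1/\<omega>^2),
  the linear exponents cancelling by symmetry; the factors 1 - z/\<omega> are multiplied row by
  row.\<close>

lemma weierstrass_sigma_limit:
  "(\<lambda>M. exp (z\<^sup>2 / 2 * eisenstein2_partial \<tau> M) * (sin (of_real pi * z) / of_real pi *
      (\<Prod>m\<in>{- int M..int M} - {0}. sin (of_real pi * (of_int m * \<tau> - z)) / sin (of_real pi * (of_int m * \<tau>)))))
    \<longlonglongrightarrow> weierstrass_sigma z (period_lattice \<tau> 1)"
proof -
  have "weierstrass_sigma z (period_lattice \<tau> 1) = z * Lim (finite_subsets_at_top nonzero_pts) (sigma_prod \<tau> z)"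
    using weierstrass_sigma_lattice_pt[OF \<tau>] by (simp add: sigma_prod_def[abs_def])
  moreover have "((\<lambda>F. z * sigma_prod \<tau> z F) \<longlongrightarrow> z * Lim (finite_subsets_at_top nonzero_pts) (sigma_prod \<tau> z)) (finite_subsets_at_top nonzero_pts)"
    by (intro tendsto_intros tendsto_sigma_prod \<tau>)
  moreover have "(\<lambda>N. z * sigma_prod \<tau> z (box_pts M N - {0})) \<longlonglongrightarrow>
    exp (z\<^sup>2 / 2 * eisenstein2_partial \<tau> M) * (sin (of_real pi * z) / of_real pi *
      (\<Prod>m\<in>{- int M..int M} - {0}. sin (of_real pi * (of_int m * \<tau> - z)) / sin (of_real pi * (of_int m * \<tau>))))" for M
  proof -
    have "z * sigma_prod \<tau> z (box_pts M N - {0}) =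
      exp (z\<^sup>2 / 2 * (\<Sum>p\<in>box_pts M N. 1 / (lattice_pt \<tau> p)\<^sup>2)) *
      ((z * (\<Prod>n\<in>{- int N..int N} - {0}. 1 - z / of_int n)) *
       (\<Prod>m\<in>{- int M..int M} - {0}. \<Prod>n\<in>{- int N..int N}. 1 - z / (of_int m * \<tau> + of_int n)))" for N
    proof -
      let ?B = "box_pts M N - {0}"
      have "(\<Sum>p\<in>?B. z / lattice_pt \<tau> p + (z / lattice_pt \<tau> p)\<^sup>2 / 2) =
          z * (\<Sum>p\<in>?B. 1 / lattice_pt \<tau> p) + z\<^sup>2 / 2 * (\<Sum>p\<in>?B. 1 / (lattice_pt \<tau> p)\<^sup>2)"
        by (simp add: sum.distrib sum_distrib_left power_divide mult.commute)
      also have "\<dots> = z\<^sup>2 / 2 * (\<Sum>p\<in>box_pts M N. 1 / (lattice_pt \<tau> p)\<^sup>2)"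
        using sum_box_pts_inverse by (simp add: sum_box_pts_minus_0)
      finally have "exp (\<Sum>p\<in>?B. z / lattice_pt \<tau> p + (z / lattice_pt \<tau> p)\<^sup>2 / 2) =
          exp (z\<^sup>2 / 2 * (\<Sum>p\<in>box_pts M N. 1 / (lattice_pt \<tau> p)\<^sup>2))"
        by (rule arg_cong)
      then have e: "(\<Prod>p\<in>?B. exp (z / lattice_pt \<tau> p + (z / lattice_pt \<tau> p)\<^sup>2 / 2)) =
          exp (z\<^sup>2 / 2 * (\<Sum>p\<in>box_pts M N. 1 / (lattice_pt \<tau> p)\<^sup>2))"
        by (simp only: exp_sum finite_Diff finite_box_pts)
      \<comment> \<open>Row 0 loses only the origin and, together with the leading z, supplies the
        sine of \<pi>z; every other row is complete and supplies a quotient of sines.\<close>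
      have B: "?B = ({0} \<times> ({- int N..int N} - {0})) \<union> (({- int M..int M} - {0}) \<times> {- int N..int N})"
        by (auto simp: box_pts_def zero_prod_def)
      have "(\<Prod>p\<in>?B. 1 - z / lattice_pt \<tau> p) =
          (\<Prod>p\<in>{0} \<times> ({- int N..int N} - {0}). 1 - z / lattice_pt \<tau> p) *
          (\<Prod>p\<in>({- int M..int M} - {0}) \<times> {- int N..int N}. 1 - z / lattice_pt \<tau> p)"
        unfolding B by (intro prod.union_disjoint) auto
      also have "\<dots> = (\<Prod>n\<in>{- int N..int N} - {0}. 1 - z / of_int n) *
          (\<Prod>m\<in>{- int M..int M} - {0}. \<Prod>n\<in>{- int N..int N}. 1 - z / (of_int m * \<tau> + of_int n))"
        unfolding prod_Times by (simp add: lattice_pt_def)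
      finally show ?thesis
        unfolding sigma_prod_def sigma_factor_def prod.distrib e by simp
    qed
    then show ?thesis
      by (simp only:) (intro tendsto_intros tendsto_prod_sin_nonzero tendsto_eisenstein2_partial
          tendsto_prod_sin_quotient not_Ints_row; auto)
  qed
  ultimately show ?thesis by (simp only: iterated_limit_box_pts)
qed

end

section \<open>Quasi-periods and translation of the sigma function\<close>

lemma sum_symmetric_telescope:
  fixes H :: "int \<Rightarrow> 'a :: ab_group_add"
  shows "(\<Sum>m\<in>{- int M..int M}. H (m - 1)) - (\<Sum>m\<in>{- int M..int M}. H m) = H (- 1 - int M) - H (int M)"
proof (induction M)
  case (Suc M)
  then show ?case unfolding atLeastAtMost_symmetric_Suc by (simp add: algebra_simps)
qed simp

text \<open>Written without division because the sines to which it is applied vanish when z is a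
  lattice point.\<close>

lemma prod_symmetric_telescope:
  fixes H :: "int \<Rightarrow> 'a :: comm_monoid_mult"
  shows "(\<Prod>m\<in>{- int M..int M}. H (m - 1)) * H (int M) = (\<Prod>m\<in>{- int M..int M}. H m) * H (- 1 - int M)"
proof (induction M)
  case (Suc M)
  have "(\<Prod>m\<in>{- int (Suc M)..int (Suc M)}. H (m - 1)) * H (int (Suc M)) =
     ((\<Prod>m\<in>{- int M..int M}. H (m - 1)) * H (int M)) * H (- 1 - int (Suc M)) * H (int (Suc M))"
    unfolding atLeastAtMost_symmetric_Suc by (simp add: mult_ac)
  also have "\<dots> = (\<Prod>m\<in>{- int (Suc M)..int (Suc M)}. H m) * H (- 1 - int (Suc M))"
    unfolding Suc.IH atLeastAtMost_symmetric_Suc by (simp add: mult_ac)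
  finally show ?case .
qed (simp add: mult.commute)

lemma exp_pi_i_of_int: "exp (of_real pi * \<i> * of_int k) = (if even k then 1 else - 1)"
proof -
  have "exp (of_real pi * \<i> * of_int (2 * j)) = 1" for j :: int
    using exp_integer_2pi[of "of_int j"] by (simp add: mult_ac)
  moreover have "exp (of_real pi * \<i> * of_int (2 * j + 1)) = - 1" for j :: int
    using \<open>exp (of_real pi * \<i> * of_int (2 * j)) = 1\<close> by (simp add: distrib_left exp_add)
  ultimately show ?thesis by (cases "even k") (auto elim!: evenE oddE simp del: of_int_mult of_int_add)
qed

lemma exp_mult_eq_imp: "a = exp x * b \<Longrightarrow> b = exp (- x) * a" for a b x :: complex
  by (simp add: exp_minus)

text \<open>The weight 2 Eisenstein series in Eisenstein's order of summation. That the outer limit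
  exists is read off from zeta in \<open>eisenstein2_partial_tendsto_zeta_diff\<close>.\<close>

definition eisenstein2 :: "complex \<Rightarrow> complex" where
  "eisenstein2 \<tau> = lim (eisenstein2_partial \<tau>)"

text \<open>Up to a factor depending only on \<tau>, the odd Jacobi theta function: removing the
  Gaussian factor leaves translation laws free of G2.\<close>

definition reduced_sigma :: "complex \<Rightarrow> complex \<Rightarrow> complex" where
  "reduced_sigma \<tau> z = exp (- (z\<^sup>2 / 2 * eisenstein2 \<tau>)) * weierstrass_sigma z (period_lattice \<tau> 1)"

context
  fixes \<tau> :: complex
  assumes \<tau>: "Im \<tau> > 0"
begin

lemma add_notin_period_lattice:
  assumes "z \<notin> period_lattice \<tau> 1"
  shows "z + (of_int l * \<tau> + of_int m) \<notin> period_lattice \<tau> 1"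
proof
  assume "z + (of_int l * \<tau> + of_int m) \<in> period_lattice \<tau> 1"
  then obtain a b where "z + (of_int l * \<tau> + of_int m) = of_int a * \<tau> + of_int b * 1"
    by (auto simp: period_lattice_def)
  then have "z = of_int (a - l) * \<tau> + of_int (b - m) * 1" by (simp add: algebra_simps)
  with assms show False unfolding period_lattice_def by blast
qed

text \<open>A point off the lattice: it makes the convergence statement for
  \<open>eisenstein2_partial\<close> applicable and forces the quasi-period, a constant valid for
  all such points, to be unique.\<close>

lemma half_notin_period_lattice: "1/2 \<notin> period_lattice \<tau> 1"
proof
  assume "1/2 \<in> period_lattice \<tau> 1"
  then obtain a b :: int where ab: "1/2 = of_int a * \<tau> + of_int b" by (auto simp: period_lattice_def)
  from arg_cong[OF ab, of Im] have "a = 0" using \<tau> by simp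
  with arg_cong[OF ab, of Re] have "real_of_int (2 * b) = 1" by simp
  then have "2 * b = 1" by (simp only: of_int_eq_1_iff)
  then show False by presburger
qed

text \<open>The cotangents have period 1 and cancel in the difference at stage M, leaving (z + 1 -
  z) times the partial Eisenstein sum. Convergence of that sum thus follows from convergence of
  zeta, and the limit cannot depend on z.\<close>

lemma eisenstein2_partial_tendsto_zeta_diff:
  assumes z: "z \<notin> period_lattice \<tau> 1"
  shows "eisenstein2_partial \<tau> \<longlonglongrightarrow>
    weierstrass_zeta (z + 1) (period_lattice \<tau> 1) - weierstrass_zeta z (period_lattice \<tau> 1)"
proof -
  have z1: "z + 1 \<notin> period_lattice \<tau> 1" using add_notin_period_lattice[OF z, of 0 1] by simp
  have cot1: "cot (of_real pi * (z + 1 - w)) = cot (of_real pi * (z - w))" for w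
  proof -
    have "of_real pi * (z + 1 - w) = of_real pi * (z - w) + of_real pi" by (simp add: algebra_simps)
    then show ?thesis unfolding cot_def by (simp add: sin_plus_pi cos_plus_pi)
  qed
  from tendsto_diff[OF weierstrass_zeta_limit[OF \<tau> z1] weierstrass_zeta_limit[OF \<tau> z]]
  show ?thesis by (simp add: cot1 distrib_right)
qed

lemma tendsto_eisenstein2: "eisenstein2_partial \<tau> \<longlonglongrightarrow> eisenstein2 \<tau>"
  unfolding eisenstein2_def
  using convergentI[OF eisenstein2_partial_tendsto_zeta_diff[OF half_notin_period_lattice]]
  by (simp add: convergent_LIMSEQ_iff)

lemma weierstrass_zeta_add_1:
  assumes z: "z \<notin> period_lattice \<tau> 1"
  shows "weierstrass_zeta (z + 1) (period_lattice \<tau> 1) = weierstrass_zeta z (period_lattice \<tau> 1) + eisenstein2 \<tau>"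
  using LIMSEQ_unique[OF tendsto_eisenstein2 eisenstein2_partial_tendsto_zeta_diff[OF z]] by simp

text \<open>Adding \<tau> shifts the row index by one, so only the rows -1 - M and M survive. Their
  arguments run to infinity in the upper and the lower half-plane, where the cotangent tends to -i
  and i; the difference is the -2\<pi>i of Legendre's relation.\<close>

lemma weierstrass_zeta_add_tau:
  assumes z: "z \<notin> period_lattice \<tau> 1"
  shows "weierstrass_zeta (z + \<tau>) (period_lattice \<tau> 1) =
    weierstrass_zeta z (period_lattice \<tau> 1) + (\<tau> * eisenstein2 \<tau> - 2 * of_real pi * \<i>)"
proof -
  have z1: "z + \<tau> \<notin> period_lattice \<tau> 1" using add_notin_period_lattice[OF z, of 1 0] by simp
  define H where "H = (\<lambda>m::int. of_real pi * cot (of_real pi * (z - of_int m * \<tau>)))"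
  have "(\<Sum>m\<in>{- int M..int M}. of_real pi * cot (of_real pi * (z + \<tau> - of_int m * \<tau>))) =
        (\<Sum>m\<in>{- int M..int M}. H (m - 1))" for M
    unfolding H_def by (intro sum.cong) (auto simp: algebra_simps)
  then have "(\<lambda>M. ((\<Sum>m\<in>{- int M..int M}. H (m - 1)) + (z + \<tau>) * eisenstein2_partial \<tau> M) -
      ((\<Sum>m\<in>{- int M..int M}. H m) + z * eisenstein2_partial \<tau> M)) \<longlonglongrightarrow>
      weierstrass_zeta (z + \<tau>) (period_lattice \<tau> 1) - weierstrass_zeta z (period_lattice \<tau> 1)"
    using tendsto_diff[OF weierstrass_zeta_limit[OF \<tau> z1] weierstrass_zeta_limit[OF \<tau> z]]
    by (simp add: H_def)
  moreover have "((\<Sum>m\<in>{- int M..int M}. H (m - 1)) + (z + \<tau>) * eisenstein2_partial \<tau> M) -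
      ((\<Sum>m\<in>{- int M..int M}. H m) + z * eisenstein2_partial \<tau> M) =
      (H (- 1 - int M) - H (int M)) + \<tau> * eisenstein2_partial \<tau> M" for M
    by (simp add: sum_symmetric_telescope[symmetric] algebra_simps)
  ultimately have "(\<lambda>M. (H (- 1 - int M) - H (int M)) + \<tau> * eisenstein2_partial \<tau> M) \<longlonglongrightarrow>
      weierstrass_zeta (z + \<tau>) (period_lattice \<tau> 1) - weierstrass_zeta z (period_lattice \<tau> 1)"
    by (simp only:)
  moreover have "(\<lambda>M. H (- 1 - int M)) \<longlonglongrightarrow> of_real pi * (- \<i>)"
  proof -
    have "H (- 1 - int M) = of_real pi * cot (of_real pi * ((z + \<tau>) + of_nat M * \<tau>))" for M
      by (simp add: H_def algebra_simps)
    then show ?thesis using tendsto_mult[OF tendsto_const tendsto_cot_upper[OF \<tau>]] by simp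
  qed
  moreover have "(\<lambda>M. H (int M)) \<longlonglongrightarrow> of_real pi * (- (- \<i>))"
  proof -
    have "H (int M) = of_real pi * (- cot (of_real pi * (- z + of_nat M * \<tau>)))" for M
      unfolding cot_minus[symmetric] by (simp add: H_def algebra_simps)
    then show ?thesis using tendsto_mult[OF tendsto_const tendsto_minus[OF tendsto_cot_upper[OF \<tau>, of "- z"]]] by simp
  qed
  ultimately have "weierstrass_zeta (z + \<tau>) (period_lattice \<tau> 1) - weierstrass_zeta z (period_lattice \<tau> 1) =
      (of_real pi * (- \<i>) - of_real pi * (- (- \<i>))) + \<tau> * eisenstein2 \<tau>"
    by (intro LIMSEQ_unique[OF _ tendsto_add[OF tendsto_diff tendsto_mult[OF tendsto_const tendsto_eisenstein2]]]) auto
  then show ?thesis by (simp add: algebra_simps)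
qed

section \<open>Quasi-periods and their real-linear extension\<close>

lemma weierstrass_zeta_add_multiple:
  assumes step: "\<And>z. z \<notin> period_lattice \<tau> 1 \<Longrightarrow>
      weierstrass_zeta (z + (of_int l * \<tau> + of_int m)) (period_lattice \<tau> 1) = weierstrass_zeta z (period_lattice \<tau> 1) + h"
    and z: "z \<notin> period_lattice \<tau> 1"
  shows "weierstrass_zeta (z + of_int k * (of_int l * \<tau> + of_int m)) (period_lattice \<tau> 1) =
         weierstrass_zeta z (period_lattice \<tau> 1) + of_int k * h"
proof (induction k rule: int_induct[where k = 0])
  case (step1 k)
  have "z + of_int k * (of_int l * \<tau> + of_int m) \<notin> period_lattice \<tau> 1"
    using add_notin_period_lattice[OF z, of "k * l" "k * m"] by (simp add: algebra_simps)
  from step[OF this] show ?case using step1 by (simp add: algebra_simps)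
next
  case (step2 k)
  have "z + of_int (k - 1) * (of_int l * \<tau> + of_int m) \<notin> period_lattice \<tau> 1"
    using add_notin_period_lattice[OF z, of "(k - 1) * l" "(k - 1) * m"] by (simp add: algebra_simps)
  from step[OF this] show ?case using step2 by (simp add: algebra_simps)
qed simp

lemma quasi_period_eq:
  "quasi_period (of_int l * \<tau> + of_int m) (period_lattice \<tau> 1) =
    eisenstein2 \<tau> * (of_int l * \<tau> + of_int m) - 2 * of_real pi * \<i> * of_int l"
proof -
  let ?L = "period_lattice \<tau> 1" and ?w = "of_int l * \<tau> + of_int m"
  let ?h = "eisenstein2 \<tau> * ?w - 2 * of_real pi * \<i> * of_int l"
  have shift: "weierstrass_zeta (z + ?w) ?L = weierstrass_zeta z ?L + ?h" if z: "z \<notin> ?L" for z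
  proof -
    have z': "z + of_int l * \<tau> \<notin> ?L" using add_notin_period_lattice[OF z, of l 0] by simp
    have "weierstrass_zeta (z + of_int l * \<tau> + of_int m) ?L = weierstrass_zeta (z + of_int l * \<tau>) ?L + of_int m * eisenstein2 \<tau>"
      using weierstrass_zeta_add_multiple[of 0 1 "eisenstein2 \<tau>", OF _ z', of m] weierstrass_zeta_add_1 by simp
    moreover have "weierstrass_zeta (z + of_int l * \<tau>) ?L =
        weierstrass_zeta z ?L + of_int l * (\<tau> * eisenstein2 \<tau> - 2 * of_real pi * \<i>)"
      using weierstrass_zeta_add_multiple[of 1 0 "\<tau> * eisenstein2 \<tau> - 2 * of_real pi * \<i>", OF _ z, of l]
        weierstrass_zeta_add_tau by simp
    ultimately show ?thesis by (simp add: algebra_simps)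
  qed
  show ?thesis
    unfolding quasi_period_def
  proof (rule the_equality)
    show "\<forall>z. z \<notin> ?L \<longrightarrow> weierstrass_zeta (z + ?w) ?L = weierstrass_zeta z ?L + ?h" using shift by blast
  next
    fix h assume "\<forall>z. z \<notin> ?L \<longrightarrow> weierstrass_zeta (z + ?w) ?L = weierstrass_zeta z ?L + h"
    with shift half_notin_period_lattice show "h = ?h" by (metis add_left_cancel)
  qed
qed

text \<open>Im z / Im \<tau> is the real coordinate of z along \<tau> in the basis (\<tau>, 1),
  equal to l at l\<tau> + m. The right side is therefore real-linear and correct on the lattice, and
  its values at \<tau> and 1 determine it.\<close>

lemma eta_ext_eq:
  "eta_ext z (period_lattice \<tau> 1) = eisenstein2 \<tau> * z - 2 * of_real pi * \<i> * of_real (Im z / Im \<tau>)"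
proof -
  let ?L = "period_lattice \<tau> 1"
  let ?h = "\<lambda>z. eisenstein2 \<tau> * z - 2 * of_real pi * \<i> * of_real (Im z / Im \<tau>)"
  have lin: "linear ?h"
    by (rule linearI) (simp_all add: scaleR_conv_of_real algebra_simps add_divide_distrib)
  have on: "?h \<omega> = quasi_period \<omega> ?L" if "\<omega> \<in> ?L" for \<omega>
  proof -
    from that obtain l m where w: "\<omega> = of_int l * \<tau> + of_int m" by (auto simp: period_lattice_def)
    show ?thesis unfolding w quasi_period_eq using \<tau> by simp
  qed
  have "(THE h. linear h \<and> (\<forall>\<omega>\<in>?L. h \<omega> = quasi_period \<omega> ?L)) = ?h"
  proof (rule the_equality)
    show "linear ?h \<and> (\<forall>\<omega>\<in>?L. ?h \<omega> = quasi_period \<omega> ?L)" using lin on by blast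
  next
    fix h assume h: "linear h \<and> (\<forall>\<omega>\<in>?L. h \<omega> = quasi_period \<omega> ?L)"
    have "\<tau> = of_int 1 * \<tau> + of_int 0 * 1" "(1::complex) = of_int 0 * \<tau> + of_int 1 * 1" by simp_all
    then have L: "\<tau> \<in> ?L" "1 \<in> ?L" unfolding period_lattice_def by blast+
    have eq: "h \<tau> = ?h \<tau>" by (rule trans[OF _ on[OF L(1), symmetric]]) (use h L in blast)
    have eq': "h 1 = ?h 1" by (rule trans[OF _ on[OF L(2), symmetric]]) (use h L in blast)
    show "h = ?h"
    proof
      fix x
      define a where "a = Im x / Im \<tau>"
      define b where "b = Re x - a * Re \<tau>"
      have x: "x = a *\<^sub>R \<tau> + b *\<^sub>R 1"
        using \<tau> by (simp add: complex_eq_iff a_def b_def)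
      have "h x = a *\<^sub>R h \<tau> + b *\<^sub>R h 1"
        unfolding x using h by (simp only: linear_add linear_scale)
      also have "\<dots> = a *\<^sub>R ?h \<tau> + b *\<^sub>R ?h 1" by (simp only: eq eq')
      also have "\<dots> = ?h x"
        unfolding x using linear_add[OF lin, of "a *\<^sub>R \<tau>" "b *\<^sub>R 1"] linear_scale[OF lin, of a \<tau>]
          linear_scale[OF lin, of b 1] by (simp only:)
      finally show "h x = ?h x" .
    qed
  qed
  then show ?thesis unfolding eta_ext_def by simp
qed

section \<open>The product of sines and its translation laws\<close>

definition sin_prod :: "complex \<Rightarrow> nat \<Rightarrow> complex" where
  "sin_prod z M = sin (of_real pi * z) / of_real pi *
      (\<Prod>m\<in>{- int M..int M} - {0}. sin (of_real pi * (of_int m * \<tau> - z)) / sin (of_real pi * (of_int m * \<tau>)))"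

text \<open>The Gaussian factor is divided out at stage M, where it contains the partial Eisenstein
  sum; the quotient converges because that sum does.\<close>

lemma tendsto_sin_prod: "sin_prod z \<longlonglongrightarrow> reduced_sigma \<tau> z"
proof -
  have "(\<lambda>M. exp (- (z\<^sup>2 / 2 * eisenstein2_partial \<tau> M)) *
      (exp (z\<^sup>2 / 2 * eisenstein2_partial \<tau> M) * sin_prod z M)) \<longlonglongrightarrow> reduced_sigma \<tau> z"
    unfolding reduced_sigma_def sin_prod_def
    by (intro tendsto_intros weierstrass_sigma_limit \<tau> tendsto_eisenstein2)
  then show ?thesis by (simp add: exp_minus flip: mult.assoc)
qed

text \<open>Puts the row m = 0 on the same footing as the others. As K does not depend on z, a
  translation of z acts on a plain product over m.\<close>

lemma sin_prod_eq: "\<exists>K. \<forall>z. sin_prod z M = K * (\<Prod>m\<in>{- int M..int M}. sin (of_real pi * (z - of_int m * \<tau>)))"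
proof (intro exI allI)
  fix z
  have "(\<Prod>m\<in>{- int M..int M}. sin (of_real pi * (z - of_int m * \<tau>))) =
      sin (of_real pi * z) * (\<Prod>m\<in>{- int M..int M} - {0}. sin (of_real pi * (z - of_int m * \<tau>)))"
    by (subst prod.remove[of _ 0]) auto
  moreover have "(\<Prod>m\<in>{- int M..int M} - {0}. sin (of_real pi * (of_int m * \<tau> - z)) / sin (of_real pi * (of_int m * \<tau>))) =
     (\<Prod>m\<in>{- int M..int M} - {0}. - 1 / sin (of_real pi * (of_int m * \<tau>))) *
     (\<Prod>m\<in>{- int M..int M} - {0}. sin (of_real pi * (z - of_int m * \<tau>)))"
    unfolding prod.distrib[symmetric]
  proof (intro prod.cong refl)
    fix m
    have "sin (of_real pi * (of_int m * \<tau> - z)) = - sin (of_real pi * (z - of_int m * \<tau>))"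
      unfolding sin_minus[symmetric] by (simp add: algebra_simps)
    then show "sin (of_real pi * (of_int m * \<tau> - z)) / sin (of_real pi * (of_int m * \<tau>)) =
      - 1 / sin (of_real pi * (of_int m * \<tau>)) * sin (of_real pi * (z - of_int m * \<tau>))" by simp
  qed
  ultimately show "sin_prod z M = (1 / of_real pi * (\<Prod>m\<in>{- int M..int M} - {0}. - 1 / sin (of_real pi * (of_int m * \<tau>)))) *
      (\<Prod>m\<in>{- int M..int M}. sin (of_real pi * (z - of_int m * \<tau>)))"
    unfolding sin_prod_def by simp
qed

text \<open>Each of the 2M + 1 sines changes sign, and their number is odd.\<close>

lemma reduced_sigma_add_1: "reduced_sigma \<tau> (z + 1) = - reduced_sigma \<tau> z"
proof -
  have neg: "sin_prod (z + 1) M = - sin_prod z M" for M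
  proof -
    obtain K where K: "\<And>z. sin_prod z M = K * (\<Prod>m\<in>{- int M..int M}. sin (of_real pi * (z - of_int m * \<tau>)))"
      using sin_prod_eq by blast
    have "sin (of_real pi * (z + 1 - of_int m * \<tau>)) = - 1 * sin (of_real pi * (z - of_int m * \<tau>))" for m
    proof -
      have "of_real pi * (z + 1 - of_int m * \<tau>) = of_real pi * (z - of_int m * \<tau>) + of_real pi" by (simp add: algebra_simps)
      then show ?thesis by (simp add: sin_plus_pi)
    qed
    then show ?thesis unfolding K by (simp only: prod.distrib prod_constant) (simp add: nat_add_distrib nat_mult_distrib power_mult)
  qed
  have "(\<lambda>M. - sin_prod z M) \<longlonglongrightarrow> reduced_sigma \<tau> (z + 1)"
    unfolding neg[symmetric] by (rule tendsto_sin_prod)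
  then show ?thesis by (rule LIMSEQ_unique[OF _ tendsto_minus[OF tendsto_sin_prod[of z]]])
qed

text \<open>Telescoping leaves one sine on each side, from the boundary rows M and -1 - M. Both grow
  like exp(-\<pi>iM\<tau>); after multiplication by exp(\<pi>iM\<tau>) they converge, and the ratio
  of the limits is the claimed factor.\<close>

lemma reduced_sigma_add_tau:
  "reduced_sigma \<tau> (z + \<tau>) = exp (of_real pi * \<i> * (1 - 2 * z - \<tau>)) * reduced_sigma \<tau> z"
proof -
  let ?e = "\<lambda>w::complex. exp (\<i> * of_real pi * w)"
  have eq: "sin_prod (z + \<tau>) M * sin (of_real pi * (z - of_int (int M) * \<tau>)) =
        sin_prod z M * sin (of_real pi * (z - of_int (- 1 - int M) * \<tau>))" for M
  proof -
    obtain K where K: "\<And>z. sin_prod z M = K * (\<Prod>m\<in>{- int M..int M}. sin (of_real pi * (z - of_int m * \<tau>)))"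
      using sin_prod_eq by blast
    have "(\<Prod>m\<in>{- int M..int M}. sin (of_real pi * (z + \<tau> - of_int m * \<tau>))) =
        (\<Prod>m\<in>{- int M..int M}. sin (of_real pi * (z - of_int (m - 1) * \<tau>)))"
      by (intro prod.cong) (auto simp: algebra_simps)
    then show ?thesis
      unfolding K using prod_symmetric_telescope[of "\<lambda>m. sin (of_real pi * (z - of_int m * \<tau>))" M]
      by (simp only: mult.assoc)
  qed
  have "?e (of_nat M * \<tau>) * sin (of_real pi * (z - of_int (int M) * \<tau>)) =
      (?e z - ?e (- z) * exp (2 * of_real pi * \<i> * (of_nat M * \<tau>))) / (2 * \<i>)" for M
    unfolding sin_pi_mult_eq by (simp add: algebra_simps flip: exp_add)
  moreover have "(\<lambda>M. (?e z - ?e (- z) * exp (2 * of_real pi * \<i> * (of_nat M * \<tau>))) / (2 * \<i>)) \<longlonglongrightarrow>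
      (?e z - ?e (- z) * 0) / (2 * \<i>)"
    by (intro tendsto_intros tendsto_exp_nome_power \<tau>) auto
  ultimately have l1: "(\<lambda>M. ?e (of_nat M * \<tau>) * sin (of_real pi * (z - of_int (int M) * \<tau>))) \<longlonglongrightarrow> ?e z / (2 * \<i>)"
    by simp
  have "?e (of_nat M * \<tau>) * sin (of_real pi * (z - of_int (- 1 - int M) * \<tau>)) =
      (?e (z + \<tau>) * exp (2 * of_real pi * \<i> * (of_nat M * \<tau>)) - ?e (- z - \<tau>)) / (2 * \<i>)" for M
  proof -
    let ?w = "z - of_int (- 1 - int M) * \<tau>"
    have "?e (of_nat M * \<tau>) * ?e ?w = ?e (z + \<tau>) * exp (2 * of_real pi * \<i> * (of_nat M * \<tau>))"
      unfolding exp_add[symmetric] by (rule arg_cong[where f = exp]) (simp add: algebra_simps)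
    moreover have "?e (of_nat M * \<tau>) * exp (- (\<i> * of_real pi * ?w)) = ?e (- z - \<tau>)"
      unfolding exp_add[symmetric] by (rule arg_cong[where f = exp]) (simp add: algebra_simps)
    ultimately show ?thesis
      by (simp only: sin_pi_mult_eq times_divide_eq_right right_diff_distrib[of "?e (of_nat M * \<tau>)"])
  qed
  moreover have "(\<lambda>M. (?e (z + \<tau>) * exp (2 * of_real pi * \<i> * (of_nat M * \<tau>)) - ?e (- z - \<tau>)) / (2 * \<i>)) \<longlonglongrightarrow>
      (?e (z + \<tau>) * 0 - ?e (- z - \<tau>)) / (2 * \<i>)"
    by (intro tendsto_intros tendsto_exp_nome_power \<tau>) auto
  ultimately have l2: "(\<lambda>M. ?e (of_nat M * \<tau>) * sin (of_real pi * (z - of_int (- 1 - int M) * \<tau>))) \<longlonglongrightarrow> - ?e (- z - \<tau>) / (2 * \<i>)"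
    by simp
  have "sin_prod (z + \<tau>) M * (?e (of_nat M * \<tau>) * sin (of_real pi * (z - of_int (int M) * \<tau>))) =
        sin_prod z M * (?e (of_nat M * \<tau>) * sin (of_real pi * (z - of_int (- 1 - int M) * \<tau>)))" for M
    using arg_cong[OF eq[of M], of "(*) (?e (of_nat M * \<tau>))"] by (simp only: mult_ac)
  with tendsto_mult[OF tendsto_sin_prod[of "z + \<tau>"] l1]
  have "(\<lambda>M. sin_prod z M * (?e (of_nat M * \<tau>) * sin (of_real pi * (z - of_int (- 1 - int M) * \<tau>)))) \<longlonglongrightarrow>
      reduced_sigma \<tau> (z + \<tau>) * (?e z / (2 * \<i>))" by (simp only:)
  then have "reduced_sigma \<tau> (z + \<tau>) * (?e z / (2 * \<i>)) = reduced_sigma \<tau> z * (- ?e (- z - \<tau>) / (2 * \<i>))"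
    by (rule LIMSEQ_unique[OF _ tendsto_mult[OF tendsto_sin_prod[of z] l2]])
  then have "reduced_sigma \<tau> (z + \<tau>) * ?e z / (2 * \<i>) = - (reduced_sigma \<tau> z * ?e (- z - \<tau>)) / (2 * \<i>)"
    by (simp only: times_divide_eq_right mult_minus_right)
  then have "reduced_sigma \<tau> (z + \<tau>) * ?e z = - (reduced_sigma \<tau> z * ?e (- z - \<tau>))"
    by (subst (asm) divide_cancel_right) simp
  then have "reduced_sigma \<tau> (z + \<tau>) * ?e z * ?e (- z) = - (reduced_sigma \<tau> z * ?e (- z - \<tau>)) * ?e (- z)" by simp
  moreover have "?e z * ?e (- z) = 1" by (simp flip: exp_add)
  moreover have "?e (- z - \<tau>) * ?e (- z) = - exp (of_real pi * \<i> * (1 - 2 * z - \<tau>))"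
  proof -
    have "exp (of_real pi * \<i> * (1 - 2 * z - \<tau>)) = exp (of_real pi * \<i>) * exp (of_real pi * \<i> * (- 2 * z - \<tau>))"
      unfolding exp_add[symmetric] by (rule arg_cong[where f = exp]) (simp add: algebra_simps)
    moreover have "?e (- z - \<tau>) * ?e (- z) = exp (of_real pi * \<i> * (- 2 * z - \<tau>))"
      unfolding exp_add[symmetric] by (rule arg_cong[where f = exp]) (simp add: algebra_simps)
    ultimately show ?thesis by (simp only: exp_pi_i) simp
  qed
  moreover have "a = h * b" if "a * e * f = - (b * g) * f" "e * f = 1" "g * f = - h" for a b e f g h :: complex
    using that by algebra
  ultimately show ?thesis by blast
qed

lemma reduced_sigma_add_int: "reduced_sigma \<tau> (z + of_int m) = exp (of_real pi * \<i> * of_int m) * reduced_sigma \<tau> z"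
proof (induction m rule: int_induct[where k = 0])
  case (step1 m)
  have "exp (of_real pi * \<i> * of_int (m + 1)) = - exp (of_real pi * \<i> * of_int m)"
    unfolding exp_pi_i_of_int by simp
  then show ?case using reduced_sigma_add_1[of "z + of_int m"] step1 by (simp add: add.assoc)
next
  case (step2 m)
  have "exp (of_real pi * \<i> * of_int (m - 1)) = - exp (of_real pi * \<i> * of_int m)"
    unfolding exp_pi_i_of_int by simp
  then show ?case using reduced_sigma_add_1[of "z + of_int (m - 1)"] step2 by simp
qed simp

text \<open>The step from j\<tau> to (j + 1)\<tau> contributes 1 - 2z - (2j + 1)\<tau> to the
  exponent, and the first l odd numbers add up to l^2; negative l are reached by inverting the
  step.\<close>

lemma reduced_sigma_add_mult_tau:
  "reduced_sigma \<tau> (z + of_int l * \<tau>) =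
     exp (of_real pi * \<i> * (of_int l - 2 * of_int l * z - of_int (l\<^sup>2) * \<tau>)) * reduced_sigma \<tau> z"
    (is "_ = exp (?q l) * _")
proof (induction l rule: int_induct[where k = 0])
  case (step1 l)
  have "reduced_sigma \<tau> (z + of_int (l + 1) * \<tau>) =
      exp (of_real pi * \<i> * (1 - 2 * (z + of_int l * \<tau>) - \<tau>)) * (exp (?q l) * reduced_sigma \<tau> z)"
    using reduced_sigma_add_tau[of "z + of_int l * \<tau>"] step1 by (simp add: algebra_simps)
  also have "\<dots> = exp (of_real pi * \<i> * (1 - 2 * (z + of_int l * \<tau>) - \<tau>) + ?q l) * reduced_sigma \<tau> z"
    by (simp add: exp_add)
  also have "of_real pi * \<i> * (1 - 2 * (z + of_int l * \<tau>) - \<tau>) + ?q l = ?q (l + 1)"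
    by (simp add: algebra_simps power2_eq_square)
  finally show ?case .
next
  case (step2 l)
  have "reduced_sigma \<tau> (z + of_int l * \<tau>) =
      exp (of_real pi * \<i> * (1 - 2 * (z + of_int (l - 1) * \<tau>) - \<tau>)) * reduced_sigma \<tau> (z + of_int (l - 1) * \<tau>)"
    using reduced_sigma_add_tau[of "z + of_int (l - 1) * \<tau>"] by (simp add: algebra_simps)
  then have "reduced_sigma \<tau> (z + of_int (l - 1) * \<tau>) =
      exp (- (of_real pi * \<i> * (1 - 2 * (z + of_int (l - 1) * \<tau>) - \<tau>))) * reduced_sigma \<tau> (z + of_int l * \<tau>)"
    by (rule exp_mult_eq_imp)
  also have "\<dots> = exp (- (of_real pi * \<i> * (1 - 2 * (z + of_int (l - 1) * \<tau>) - \<tau>)) + ?q l) * reduced_sigma \<tau> z"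
    unfolding step2(2) by (simp only: exp_add mult.assoc)
  also have "- (of_real pi * \<i> * (1 - 2 * (z + of_int (l - 1) * \<tau>) - \<tau>)) + ?q l = ?q (l - 1)"
    by (simp add: algebra_simps power2_eq_square)
  finally show ?case .
qed simp

text \<open>As 1 + (l + m + lm) = (1 + l)(1 + m), the exponent is even exactly when l and m are both
  even, that is, when the lattice point lies in 2L.\<close>

lemma psi_eq:
  "psi (of_int l * \<tau> + of_int m) (period_lattice \<tau> 1) = exp (of_real pi * \<i> * of_int (l + m + l * m))"
proof -
  let ?L = "period_lattice \<tau> 1"
  have w: "of_int l * \<tau> + of_int m = lattice_pt \<tau> (l, m)" by (simp add: lattice_pt_def)
  have "lattice_pt \<tau> (l, m) \<in> (\<lambda>\<omega>. 2 * \<omega>) ` ?L \<longleftrightarrow> even l \<and> even m"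
  proof
    assume "lattice_pt \<tau> (l, m) \<in> (\<lambda>\<omega>. 2 * \<omega>) ` ?L"
    then obtain a b where "lattice_pt \<tau> (l, m) = 2 * lattice_pt \<tau> (a, b)" by (auto simp: period_lattice_eq_range)
    also have "\<dots> = lattice_pt \<tau> (2 * a, 2 * b)" by (simp add: lattice_pt_def algebra_simps)
    finally have "(l, m) = (2 * a, 2 * b)" using inj_lattice_pt[OF \<tau>] by (rule injD[rotated])
    then show "even l \<and> even m" by simp
  next
    assume "even l \<and> even m"
    then obtain a b where "l = 2 * a" "m = 2 * b" by (auto elim!: evenE)
    then have "lattice_pt \<tau> (l, m) = 2 * lattice_pt \<tau> (a, b)" by (simp add: lattice_pt_def algebra_simps)
    then show "lattice_pt \<tau> (l, m) \<in> (\<lambda>\<omega>. 2 * \<omega>) ` ?L" by (auto simp: period_lattice_eq_range)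
  qed
  then show ?thesis
    unfolding w psi_def exp_pi_i_of_int by (auto simp: period_lattice_eq_range)
qed

text \<open>Both sides are an exponential times \<open>reduced_sigma\<close>, and the exponents
  agree identically: the term lm from \<open>psi_eq\<close> cancels the -\<pi>ilm in -2\<pi>il *
  \<omega>/2, which comes from \<eta>.\<close>

lemma weierstrass_sigma_translate:
  fixes l m :: int
  defines "\<omega> \<equiv> of_int l * \<tau> + of_int m"
  shows "weierstrass_sigma (z + \<omega>) (period_lattice \<tau> 1) =
    psi \<omega> (period_lattice \<tau> 1) * exp (eta_ext \<omega> (period_lattice \<tau> 1) * (z + \<omega> / 2)) *
    weierstrass_sigma z (period_lattice \<tau> 1)"
proof -
  have sig: "weierstrass_sigma w (period_lattice \<tau> 1) = exp (w\<^sup>2 / 2 * eisenstein2 \<tau>) * reduced_sigma \<tau> w" for w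
    by (simp add: reduced_sigma_def exp_minus)
  have "reduced_sigma \<tau> (z + \<omega>) = exp (of_real pi * \<i> * of_int m) *
      (exp (of_real pi * \<i> * (of_int l - 2 * of_int l * z - of_int (l\<^sup>2) * \<tau>)) * reduced_sigma \<tau> z)"
    using reduced_sigma_add_int[of "z + of_int l * \<tau>" m] reduced_sigma_add_mult_tau[of z l]
    by (simp add: \<omega>_def add.assoc)
  also have "\<dots> = exp (of_real pi * \<i> * (of_int (l + m) - 2 * of_int l * z - of_int (l\<^sup>2) * \<tau>)) * reduced_sigma \<tau> z"
    by (simp add: algebra_simps flip: exp_add)
  finally have 1: "weierstrass_sigma (z + \<omega>) (period_lattice \<tau> 1) = exp ((z + \<omega>)\<^sup>2 / 2 * eisenstein2 \<tau> +
      of_real pi * \<i> * (of_int (l + m) - 2 * of_int l * z - of_int (l\<^sup>2) * \<tau>)) * reduced_sigma \<tau> z"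
    unfolding sig by (simp add: exp_add)
  have eta: "eta_ext \<omega> (period_lattice \<tau> 1) = eisenstein2 \<tau> * \<omega> - 2 * of_real pi * \<i> * of_int l"
    unfolding eta_ext_eq \<omega>_def using \<tau> by simp
  have "psi \<omega> (period_lattice \<tau> 1) * exp (eta_ext \<omega> (period_lattice \<tau> 1) * (z + \<omega> / 2)) *
      weierstrass_sigma z (period_lattice \<tau> 1) =
      exp (of_real pi * \<i> * of_int (l + m + l * m) + (eisenstein2 \<tau> * \<omega> - 2 * of_real pi * \<i> * of_int l) * (z + \<omega> / 2)
        + z\<^sup>2 / 2 * eisenstein2 \<tau>) * reduced_sigma \<tau> z"
    unfolding sig eta psi_eq[of l m, folded \<omega>_def] by (simp only: exp_add mult.assoc)
  also have "of_real pi * \<i> * of_int (l + m + l * m) + (eisenstein2 \<tau> * \<omega> - 2 * of_real pi * \<i> * of_int l) * (z + \<omega> / 2)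
        + z\<^sup>2 / 2 * eisenstein2 \<tau> = (z + \<omega>)\<^sup>2 / 2 * eisenstein2 \<tau> +
      of_real pi * \<i> * (of_int (l + m) - 2 * of_int l * z - of_int (l\<^sup>2) * \<tau>)"
    unfolding \<omega>_def by (simp add: field_simps power2_eq_square)
  finally show ?thesis using 1 by simp
qed

lemma slash_ell_weierstrass_sigma:
  "slash_ell (-1) (of_int l) (of_int m) (\<lambda>\<tau> z. weierstrass_sigma z (period_lattice \<tau> 1)) \<tau> z =
     weierstrass_sigma z (period_lattice \<tau> 1)"
proof -
  let ?w = "of_int l * \<tau> + of_int m"
  define X where "X = psi ?w (period_lattice \<tau> 1) * exp (eta_ext ?w (period_lattice \<tau> 1) * (z + ?w / 2))"
  have "X \<noteq> 0" unfolding X_def psi_eq by simp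
  moreover have "weierstrass_sigma (z + ?w) (period_lattice \<tau> 1) = X * weierstrass_sigma z (period_lattice \<tau> 1)"
    using weierstrass_sigma_translate[of z l m] by (simp add: X_def)
  moreover have "slash_ell (-1) (of_int l) (of_int m) (\<lambda>\<tau> z. weierstrass_sigma z (period_lattice \<tau> 1)) \<tau> z =
      X powi (-1) * weierstrass_sigma (z + ?w) (period_lattice \<tau> 1)"
    by (simp add: slash_ell_def Let_def X_def)
  ultimately show ?thesis by (simp add: power_int_minus)
qed

end

section \<open>Expansion in the nome\<close>

text \<open>Equals (1 - q^m \<zeta>)(1 - q^m/\<zeta>) / (1 - q^m)^2. The form 1 + O(q^m) is the one
  that the convergence theorem for products takes, and it shows which powers of q the factor
  affects.\<close>

definition nome_factor :: "complex \<Rightarrow> nat \<Rightarrow> complex \<Rightarrow> complex" where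
  "nome_factor \<zeta> m q = 1 + (2 - \<zeta> - 1 / \<zeta>) * inverse ((1 - q ^ m)\<^sup>2) * q ^ m"

definition nome_factor_fps :: "complex \<Rightarrow> nat \<Rightarrow> complex fps" where
  "nome_factor_fps \<zeta> m = 1 + fps_const (2 - \<zeta> - 1 / \<zeta>) * inverse ((1 - fps_X ^ m)\<^sup>2) * fps_X ^ m"

lemma has_fps_expansion_nome_factor:
  assumes "m \<ge> 1" shows "nome_factor \<zeta> m has_fps_expansion nome_factor_fps \<zeta> m"
  unfolding nome_factor_def[abs_def] nome_factor_fps_def
  using assms by (intro fps_expansion_intros) (auto simp: power2_eq_square)

text \<open>The factor with index M + 1 is 1 plus a multiple of X^(M + 1), so it leaves all
  coefficients up to X^M unchanged.\<close>

lemma nome_factor_prod_nth_stable: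
  assumes "n \<le> M"
  shows "(\<Prod>m=1..M. nome_factor_fps \<zeta> m) $ n = (\<Prod>m=1..n. nome_factor_fps \<zeta> m) $ n"
  using assms
proof (induction M rule: dec_induct)
  case (step M)
  let ?P = "\<Prod>m=1..M. nome_factor_fps \<zeta> m"
  have "(\<Prod>m=1..Suc M. nome_factor_fps \<zeta> m) = ?P + ?P * (fps_const (2 - \<zeta> - 1 / \<zeta>) * inverse ((1 - fps_X ^ Suc M)\<^sup>2)) * fps_X ^ Suc M"
    by (simp add: nome_factor_fps_def algebra_simps del: power_Suc)
  then show ?case using step by (simp add: fps_X_power_mult_right_nth del: power_Suc)
qed simp

text \<open>The factored form, in which powers of \<zeta> can be tracked: two binomials, shifting
  the exponent of \<zeta> by 1 and by -1, and a series free of \<zeta>.\<close>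

lemma nome_factor_fps_eq:
  assumes "m \<ge> 1" "\<zeta> \<noteq> 0"
  shows "nome_factor_fps \<zeta> m = (1 - fps_const (\<zeta> powi 1) * fps_X ^ m) * (1 - fps_const (\<zeta> powi (-1)) * fps_X ^ m)
    * inverse ((1 - fps_X ^ m)\<^sup>2)"
proof -
  let ?x = "fps_X ^ m :: complex fps" and ?c = "fps_const \<zeta>" and ?c' = "fps_const (1 / \<zeta>)"
  have I: "(1 - ?x)\<^sup>2 * inverse ((1 - ?x)\<^sup>2) = 1"
    using assms by (intro inverse_mult_eq_1') (simp add: power2_eq_square)
  have c: "?c * ?c' = 1" using assms by (simp add: fps_const_mult)
  have "nome_factor_fps \<zeta> m = 1 + (2 - ?c - ?c') * inverse ((1 - ?x)\<^sup>2) * ?x"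
    unfolding nome_factor_fps_def by (simp flip: fps_const_sub numeral_fps_const)
  also have "\<dots> = (1 - ?c * ?x) * (1 - ?c' * ?x) * inverse ((1 - ?x)\<^sup>2)"
  proof -
    have "1 + (2 - c - c') * i * x = (1 - c * x) * (1 - c' * x) * i"
      if "(1 - x)\<^sup>2 * i = 1" "c * c' = 1" for c c' x i :: "complex fps"
    proof -
      have "(1 - c * x) * (1 - c' * x) * i = (1 - x)\<^sup>2 * i + (2 - c - c') * i * x + (c * c' - 1) * x\<^sup>2 * i"
        by (simp add: algebra_simps power2_eq_square)
      then show ?thesis using that by simp
    qed
    from this[OF I c] show ?thesis .
  qed
  finally show ?thesis by (simp add: power_int_minus inverse_eq_divide)
qed

text \<open>Says that the q-coefficients of f are Laurent polynomials in \<zeta> supported in the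
  parabola r(r - 1) \<le> 2n. The window from lo to hi is carried along because a binomial preserves
  the parabola only for exponents that are not yet too large in modulus.\<close>

definition laurent_supported :: "(complex \<Rightarrow> complex fps) \<Rightarrow> int \<Rightarrow> int \<Rightarrow> (nat \<Rightarrow> int \<Rightarrow> complex) \<Rightarrow> bool" where
  "laurent_supported f lo hi c \<longleftrightarrow>
     (\<forall>n r. c n r \<noteq> 0 \<longrightarrow> lo \<le> r \<and> r \<le> hi \<and> r * (r - 1) \<le> 2 * int n) \<and>
     (\<forall>\<zeta> n. \<zeta> \<noteq> 0 \<longrightarrow> f \<zeta> $ n = (\<Sum>r\<in>{lo..hi}. c n r * \<zeta> powi r))"

text \<open>The new term moves a monomial from (n, r) to (n + m, r + s). The hypothesis
  \<open>quad\<close> says that r(r - 1) then grows by at most 2m; for s = 1 this means r \<le> m,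
  for s = -1 it means r \<ge> 1 - m.\<close>

lemma laurent_supported_mult_binomial:
  assumes f: "laurent_supported f lo hi c"
    and range: "lo' \<le> lo" "hi \<le> hi'" "lo' \<le> lo + s" "hi + s \<le> hi'"
    and quad: "\<And>r. lo \<le> r \<Longrightarrow> r \<le> hi \<Longrightarrow> (r + s) * (r + s - 1) \<le> r * (r - 1) + 2 * int m"
  shows "laurent_supported (\<lambda>\<zeta>. f \<zeta> * (1 - fps_const (\<zeta> powi s) * fps_X ^ m)) lo' hi'
    (\<lambda>n r. c n r - (if m \<le> n then c (n - m) (r - s) else 0))"
  unfolding laurent_supported_def
proof (intro conjI allI impI)
  fix n r
  assume nz: "c n r - (if m \<le> n then c (n - m) (r - s) else 0) \<noteq> 0"
  have supp: "lo \<le> r \<and> r \<le> hi \<and> r * (r - 1) \<le> 2 * int n" if "c n r \<noteq> 0" for n r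
    using f that unfolding laurent_supported_def by blast
  have "c n r \<noteq> 0 \<or> (m \<le> n \<and> c (n - m) (r - s) \<noteq> 0)" using nz by (auto split: if_splits)
  then have "lo' \<le> r \<and> r \<le> hi' \<and> r * (r - 1) \<le> 2 * int n"
  proof
    assume "c n r \<noteq> 0"
    with supp range show ?thesis by force
  next
    assume a: "m \<le> n \<and> c (n - m) (r - s) \<noteq> 0"
    with supp have s: "lo \<le> r - s" "r - s \<le> hi" "(r - s) * (r - s - 1) \<le> 2 * int (n - m)" by blast+
    have "r * (r - 1) \<le> (r - s) * (r - s - 1) + 2 * int m" using quad[OF s(1,2)] by simp
    also have "\<dots> \<le> 2 * int n" using s(3) a by (simp add: of_nat_diff)
    finally show ?thesis using s range by linarith
  qed
  then show "lo' \<le> r" "r \<le> hi'" "r * (r - 1) \<le> 2 * int n" by blast+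
next
  fix \<zeta> :: complex and n assume \<zeta>: "\<zeta> \<noteq> 0"
  have eq: "f \<zeta> $ n = (\<Sum>r\<in>{lo..hi}. c n r * \<zeta> powi r)" for n
    using f \<zeta> unfolding laurent_supported_def by blast
  have zero: "c n r = 0" if "r \<notin> {lo..hi}" for n r
    using f that unfolding laurent_supported_def by fastforce
  have 1: "(\<Sum>r\<in>{lo..hi}. c n r * \<zeta> powi r) = (\<Sum>r\<in>{lo'..hi'}. c n r * \<zeta> powi r)" for n
    using zero range by (intro sum.mono_neutral_left) auto
  have 2: "\<zeta> powi s * (\<Sum>r\<in>{lo..hi}. c n r * \<zeta> powi r) = (\<Sum>r\<in>{lo'..hi'}. c n (r - s) * \<zeta> powi r)" for n
  proof -
    have "\<zeta> powi s * (\<Sum>r\<in>{lo..hi}. c n r * \<zeta> powi r) = (\<Sum>r\<in>{lo..hi}. c n r * \<zeta> powi (r + s))"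
      using \<zeta> by (simp add: sum_distrib_left power_int_add mult_ac)
    also have "\<dots> = (\<Sum>r\<in>{lo + s..hi + s}. c n (r - s) * \<zeta> powi r)"
      by (rule sum.reindex_bij_witness[of _ "\<lambda>r. r - s" "\<lambda>r. r + s"]) auto
    also have "\<dots> = (\<Sum>r\<in>{lo'..hi'}. c n (r - s) * \<zeta> powi r)"
      using zero range by (intro sum.mono_neutral_left) auto
    finally show ?thesis .
  qed
  have "(f \<zeta> * (1 - fps_const (\<zeta> powi s) * fps_X ^ m)) $ n =
      f \<zeta> $ n - \<zeta> powi s * (if m \<le> n then f \<zeta> $ (n - m) else 0)"
  proof -
    have "f \<zeta> * (1 - fps_const (\<zeta> powi s) * fps_X ^ m) = f \<zeta> - fps_const (\<zeta> powi s) * (f \<zeta> * fps_X ^ m)"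
      by (simp add: algebra_simps)
    then show ?thesis by (simp add: fps_X_power_mult_right_nth)
  qed
  also have "\<dots> = (\<Sum>r\<in>{lo'..hi'}. (c n r - (if m \<le> n then c (n - m) (r - s) else 0)) * \<zeta> powi r)"
    using 1 2 by (simp add: eq sum_subtractf left_diff_distrib)
  finally show "(f \<zeta> * (1 - fps_const (\<zeta> powi s) * fps_X ^ m)) $ n =
     (\<Sum>r\<in>{lo'..hi'}. (c n r - (if m \<le> n then c (n - m) (r - s) else 0)) * \<zeta> powi r)" .
qed

text \<open>A series without \<zeta> leaves r alone and can only raise n, which weakens the
  quadratic constraint.\<close>

lemma laurent_supported_mult_fps:
  assumes f: "laurent_supported f lo hi c"
  shows "laurent_supported (\<lambda>\<zeta>. f \<zeta> * g) lo hi (\<lambda>n r. \<Sum>i=0..n. c i r * g $ (n - i))"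
  unfolding laurent_supported_def
proof (intro conjI allI impI)
  fix n r
  assume "(\<Sum>i=0..n. c i r * g $ (n - i)) \<noteq> 0"
  then obtain i where i: "i \<le> n" "c i r \<noteq> 0" by (auto elim!: sum.not_neutral_contains_not_neutral)
  then have "lo \<le> r \<and> r \<le> hi \<and> r * (r - 1) \<le> 2 * int i"
    using f unfolding laurent_supported_def by blast
  then show "lo \<le> r" "r \<le> hi" "r * (r - 1) \<le> 2 * int n" using i by linarith+
next
  fix \<zeta> :: complex and n assume \<zeta>: "\<zeta> \<noteq> 0"
  have "(f \<zeta> * g) $ n = (\<Sum>i=0..n. (\<Sum>r\<in>{lo..hi}. c i r * \<zeta> powi r) * g $ (n - i))"
    using f \<zeta> unfolding laurent_supported_def fps_mult_nth by simp
  also have "\<dots> = (\<Sum>i=0..n. \<Sum>r\<in>{lo..hi}. c i r * g $ (n - i) * \<zeta> powi r)"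
    by (simp only: sum_distrib_right) (simp add: mult_ac)
  also have "\<dots> = (\<Sum>r\<in>{lo..hi}. (\<Sum>i=0..n. c i r * g $ (n - i)) * \<zeta> powi r)"
    by (subst sum.swap) (simp add: sum_distrib_right)
  finally show "(f \<zeta> * g) $ n = (\<Sum>r\<in>{lo..hi}. (\<Sum>i=0..n. c i r * g $ (n - i)) * \<zeta> powi r)" .
qed

lemma laurent_supported_cong:
  assumes "laurent_supported f lo hi c" "\<And>\<zeta>. \<zeta> \<noteq> 0 \<Longrightarrow> g \<zeta> = f \<zeta>"
  shows "laurent_supported g lo hi c"
  using assms unfolding laurent_supported_def by simp

lemma laurent_supported_nome_prod:
  "\<exists>c. laurent_supported (\<lambda>\<zeta>. fps_const (\<zeta> - 1) * (\<Prod>m=1..M. nome_factor_fps \<zeta> m)) (- int M) (int M + 1) c"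
proof (induction M)
  case 0
  have "laurent_supported (\<lambda>\<zeta>. fps_const (\<zeta> - 1)) 0 1
      (\<lambda>n r. if n = 0 \<and> r = 0 then - 1 else if n = 0 \<and> r = 1 then 1 else 0)"
    unfolding laurent_supported_def
  proof (intro conjI allI impI)
    have "{0..1} = {0, 1::int}" by auto
    then show "fps_const (\<zeta> - 1) $ n =
      (\<Sum>r\<in>{0..1}. (if n = 0 \<and> r = 0 then - 1 else if n = 0 \<and> r = 1 then 1 else 0) * \<zeta> powi r)" for \<zeta> :: complex and n
      by simp
  qed (auto split: if_splits)
  then show ?case by auto
next
  case (Suc M)
  then obtain c where c: "laurent_supported (\<lambda>\<zeta>. fps_const (\<zeta> - 1) * (\<Prod>m=1..M. nome_factor_fps \<zeta> m)) (- int M) (int M + 1) c"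
    by blast
  \<comment> \<open>With s = 1 and m = M + 1 the requirement is r \<le> M + 1, exactly the upper end
    of the window.\<close>
  from laurent_supported_mult_binomial[OF c, of "- int M" "int M + 2" 1 "Suc M"]
  obtain c' where c': "laurent_supported (\<lambda>\<zeta>. fps_const (\<zeta> - 1) * (\<Prod>m=1..M. nome_factor_fps \<zeta> m) *
       (1 - fps_const (\<zeta> powi 1) * fps_X ^ Suc M)) (- int M) (int M + 2) c'"
    by (auto simp: algebra_simps)
  \<comment> \<open>With s = -1 and m = M + 1 the requirement is r \<ge> -M, exactly the lower end
    of the window.\<close>
  from laurent_supported_mult_binomial[OF c', of "- int (Suc M)" "int (Suc M) + 1" "-1" "Suc M"]
  obtain c'' where c'': "laurent_supported (\<lambda>\<zeta>. fps_const (\<zeta> - 1) * (\<Prod>m=1..M. nome_factor_fps \<zeta> m) *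
       (1 - fps_const (\<zeta> powi 1) * fps_X ^ Suc M) * (1 - fps_const (\<zeta> powi (-1)) * fps_X ^ Suc M))
       (- int (Suc M)) (int (Suc M) + 1) c''"
    by (auto simp: algebra_simps)
  from laurent_supported_mult_fps[OF c'', of "inverse ((1 - fps_X ^ Suc M)\<^sup>2)"]
  show ?case
    by (intro exI) (erule laurent_supported_cong, subst prod.nat_ivl_Suc', auto simp: nome_factor_fps_eq mult_ac simp del: power_Suc)
qed

text \<open>For |q| \<le> r and m \<ge> 1 one has |1 - q^m| \<ge> 1 - r, so the deviation of the
  factor from 1 is at most K r^m. The initial segments are cofinal among the finite sets of indices,
  which turns the unconditional limit into a sequential one.\<close>

lemma uniform_limit_nome_prod:
  assumes r: "0 \<le> r" "r < 1"
  shows "\<exists>F. uniform_limit (cball 0 r) (\<lambda>M q. \<Prod>m=1..M. nome_factor \<zeta> m q) F sequentially"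
proof -
  define w where "w = (\<lambda>m q. (2 - \<zeta> - 1 / \<zeta>) * inverse ((1 - q ^ m)\<^sup>2) * q ^ m)"
  define K where "K = norm (2 - \<zeta> - 1 / \<zeta>) * inverse ((1 - r)\<^sup>2)"
  have bound: "norm (w m q) \<le> K * r ^ m" if "m \<in> {1..}" "q \<in> cball 0 r" for m q
  proof -
    have q: "norm q \<le> r" using that by simp
    have qm: "norm (q ^ m) \<le> r ^ m" unfolding norm_power using q by (intro power_mono) auto
    also have "r ^ m \<le> r" using that r power_decreasing[of 1 m r] by simp
    finally have "1 - r \<le> norm (1 - q ^ m)" using norm_triangle_ineq2[of 1 "q ^ m"] by simp
    then have "inverse (norm (1 - q ^ m) ^ 2) \<le> inverse ((1 - r)\<^sup>2)"
      using r by (intro le_imp_inverse_le power_mono) auto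
    then show ?thesis
      unfolding w_def K_def norm_mult norm_inverse norm_power[of _ 2]
      using qm r by (intro mult_mono) (auto simp: norm_power)
  qed
  have "(\<lambda>m. K * r ^ m) summable_on UNIV"
    using r by (subst summable_on_UNIV_nonneg_real_iff) (auto simp: K_def intro!: summable_mult summable_geometric)
  then have sm: "(\<lambda>m. K * r ^ m) summable_on {1..}"
    by (rule summable_on_subset_banach) auto
  have flim: "filterlim (\<lambda>M. {1..M}) (finite_subsets_at_top {1..}) (sequentially :: nat filter)"
    unfolding filterlim_finite_subsets_at_top
  proof safe
    fix X :: "nat set" assume X: "finite X" "X \<subseteq> {1..}"
    have "X \<subseteq> {1..M}" if "M \<ge> Max X" for M
    proof
      fix x assume "x \<in> X"
      then have "1 \<le> x" "x \<le> M" using X(2) order_trans[OF Max_ge[OF X(1)] that] by auto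
      then show "x \<in> {1..M}" by simp
    qed
    then show "\<forall>\<^sub>F M in sequentially. finite {1..M} \<and> X \<subseteq> {1..M} \<and> {1..M} \<subseteq> {1..}"
      by (intro eventually_mono[OF eventually_ge_at_top[of "Max X"]]) auto
  qed
  have nf: "nome_factor \<zeta> m q = 1 + w m q" for m q by (simp add: nome_factor_def w_def)
  show ?thesis
    unfolding nf by (rule exI, rule filterlim_compose[OF uniform_limit_unconditional_prod[OF sm bound] flim])
qed

text \<open>By Weierstrass's theorem the limit is holomorphic in q and its Taylor coefficients are
  the limits of those of the partial products. The n-th one is constant from M = n on, so it can be
  read off at M = n.\<close>

lemma nome_prod_sums:
  assumes q: "norm q < 1" and lim: "(\<lambda>M. \<Prod>m=1..M. nome_factor \<zeta> m q) \<longlonglongrightarrow> l"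
  shows "(\<lambda>n. (\<Prod>m=1..n. nome_factor_fps \<zeta> m) $ n * q ^ n) sums l"
proof -
  \<comment> \<open>Any radius strictly between |q| and 1 would do.\<close>
  define r where "r = (norm q + 1) / 2"
  have r: "norm q < r" "r < 1" "0 < r" using q norm_ge_zero[of q] by (auto simp: r_def intro: add_nonneg_pos)
  define P where "P = (\<lambda>M q. \<Prod>m=1..M. nome_factor \<zeta> m q)"
  obtain F where F: "uniform_limit (cball 0 r) P F sequentially"
    using uniform_limit_nome_prod[of r \<zeta>] r unfolding P_def by auto
  have ne: "1 - x ^ m \<noteq> 0" if "norm x \<le> r" "m \<ge> 1" for x :: complex and m
  proof -
    have "norm x < 1" using that r by simp
    then have "norm (x ^ m) < 1" using that by (simp add: norm_power power_less_one_iff)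
    then show ?thesis by auto
  qed
  have hol: "P M holomorphic_on cball 0 r" for M
    unfolding P_def nome_factor_def by (intro holomorphic_intros) (use ne in auto)
  have "F holomorphic_on ball 0 r"
    by (rule holomorphic_uniform_limit[OF _ F])
       (auto intro!: always_eventually holomorphic_on_imp_continuous_on hol holomorphic_on_subset[OF hol])
  then have "(\<lambda>n. (deriv ^^ n) F 0 / fact n * (q - 0) ^ n) sums F q"
    using r by (intro holomorphic_power_series) auto
  moreover have "F q = l"
    using tendsto_uniform_limitI[OF F, of q] r lim unfolding P_def by (auto intro: LIMSEQ_unique)
  moreover have "(deriv ^^ n) F 0 / fact n = (\<Prod>m=1..n. nome_factor_fps \<zeta> m) $ n" for n
  proof -
    have "(\<lambda>M. (deriv ^^ n) (P M) 0) \<longlonglongrightarrow> (deriv ^^ n) F 0"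
      by (rule higher_deriv_complex_uniform_limit[OF uniform_limit_on_subset[OF F, of "ball 0 r"]])
         (use r in \<open>auto intro!: always_eventually holomorphic_on_subset[OF hol]\<close>)
    then have "(\<lambda>M. (deriv ^^ n) (P M) 0 / fact n) \<longlonglongrightarrow> (deriv ^^ n) F 0 / fact n"
      by (intro tendsto_intros) auto
    moreover have "\<forall>\<^sub>F M in sequentially. (deriv ^^ n) (P M) 0 / fact n = (\<Prod>m=1..n. nome_factor_fps \<zeta> m) $ n"
      using eventually_ge_at_top[of n]
    proof eventually_elim
      case (elim M)
      have "P M has_fps_expansion (\<Prod>m=1..M. nome_factor_fps \<zeta> m)"
        unfolding P_def by (intro has_fps_expansion_prod has_fps_expansion_nome_factor) auto
      from fps_nth_fps_expansion[OF this, of n] nome_factor_prod_nth_stable[OF elim, of \<zeta>]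
      show ?case by simp
    qed
    ultimately show ?thesis by (rule LIMSEQ_unique[OF _ tendsto_eventually])
  qed
  ultimately show ?thesis by simp
qed

text \<open>Rows m and -m are paired. With a = exp(\<pi>im\<tau>) and b = exp(\<pi>iz) the four
  sines combine to (b^2 - a^2)(1 - a^2 b^2) / (b^2 (1 - a^2)^2), in which only a^2 = q^m and b^2 =
  \<zeta> occur. The prefactor turns sin(\<pi>z)/\<pi> from row 0 into (\<zeta> -
  1)/(2\<pi>i).\<close>

lemma exp_mult_sin_prod:
  assumes \<tau>: "Im \<tau> > 0"
  shows "exp (of_real pi * \<i> * z) * sin_prod \<tau> z M =
    (unit_exp z - 1) / (2 * of_real pi * \<i>) * (\<Prod>m=1..M. nome_factor (unit_exp z) m (unit_exp \<tau>))"
proof -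
  let ?e = "\<lambda>w::complex. exp (\<i> * of_real pi * w)"
  have "sin (of_real pi * (of_int (int m) * \<tau> - z)) / sin (of_real pi * (of_int (int m) * \<tau>)) *
     (sin (of_real pi * (of_int (- int m) * \<tau> - z)) / sin (of_real pi * (of_int (- int m) * \<tau>))) =
     nome_factor (unit_exp z) m (unit_exp \<tau>)" if m: "m \<ge> 1" for m
  proof -
    define a where "a = ?e (of_nat m * \<tau>)"
    define b where "b = ?e z"
    have ab: "a \<noteq> 0" "b \<noteq> 0" by (auto simp: a_def b_def)
    have qm: "unit_exp \<tau> ^ m = a\<^sup>2"
      unfolding unit_exp_def a_def exp_of_nat_mult[symmetric] exp_double[symmetric]
      by (rule arg_cong[where f = exp]) (simp add: mult_ac)
    have zb: "unit_exp z = b\<^sup>2"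
      unfolding unit_exp_def b_def exp_double[symmetric] by (rule arg_cong[where f = exp]) (simp add: mult_ac)
    have "norm (unit_exp \<tau>) < 1" using \<tau> by (simp add: unit_exp_def)
    then have "norm (unit_exp \<tau> ^ m) < 1" using m by (simp add: norm_power power_less_one_iff)
    then have a1: "1 - a\<^sup>2 \<noteq> 0" unfolding qm by auto
    have s1: "sin (of_real pi * (of_int (int m) * \<tau> - z)) = (a / b - b / a) / (2 * \<i>)"
      unfolding sin_pi_mult_eq a_def b_def exp_diff[symmetric] by (simp add: right_diff_distrib)
    have s2: "sin (of_real pi * (of_int (int m) * \<tau>)) = (a - 1 / a) / (2 * \<i>)"
      unfolding sin_pi_mult_eq a_def by (simp add: exp_minus inverse_eq_divide)
    have s3: "sin (of_real pi * (of_int (- int m) * \<tau> - z)) = (1 / (a * b) - a * b) / (2 * \<i>)"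
    proof -
      have "exp (\<i> * of_real pi * (of_int (- int m) * \<tau> - z)) = 1 / (a * b)"
        unfolding a_def b_def exp_add[symmetric] inverse_eq_divide[symmetric] exp_minus[symmetric]
        by (rule arg_cong[where f = exp]) (simp add: algebra_simps)
      moreover have "exp (- (\<i> * of_real pi * (of_int (- int m) * \<tau> - z))) = a * b"
        unfolding a_def b_def exp_add[symmetric]
        by (rule arg_cong[where f = exp]) (simp add: algebra_simps)
      ultimately show ?thesis unfolding sin_pi_mult_eq by (simp only:)
    qed
    have s4: "sin (of_real pi * (of_int (- int m) * \<tau>)) = - ((a - 1 / a) / (2 * \<i>))"
      unfolding s2[symmetric] sin_minus[symmetric] by simp
    have ii: "2 * \<i> \<noteq> 0" by simp
    have x1: "(a / b - b / a) / k / ((a - 1 / a) / k) = (a\<^sup>2 - b\<^sup>2) / (b * (a\<^sup>2 - 1))"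
      and x2: "(1 / (a * b) - a * b) / k / (- ((a - 1 / a) / k)) = (1 - a\<^sup>2 * b\<^sup>2) / (b * (1 - a\<^sup>2))" if "k \<noteq> 0" for k
    proof -
      have "a / b - b / a = (a\<^sup>2 - b\<^sup>2) / (a * b)" "1 / (a * b) - a * b = (1 - a\<^sup>2 * b\<^sup>2) / (a * b)"
        "a - 1 / a = (a\<^sup>2 - 1) / a" "- (a - 1 / a) = (1 - a\<^sup>2) / a"
        using ab by (simp_all add: field_simps power2_eq_square)
      then show "(a / b - b / a) / k / ((a - 1 / a) / k) = (a\<^sup>2 - b\<^sup>2) / (b * (a\<^sup>2 - 1))"
        "(1 / (a * b) - a * b) / k / (- ((a - 1 / a) / k)) = (1 - a\<^sup>2 * b\<^sup>2) / (b * (1 - a\<^sup>2))"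
        using ab that unfolding minus_divide_left by simp_all
    qed
    have "(a\<^sup>2 - b\<^sup>2) / (b * (a\<^sup>2 - 1)) * ((1 - a\<^sup>2 * b\<^sup>2) / (b * (1 - a\<^sup>2))) =
      ((b\<^sup>2 - a\<^sup>2) * (1 - a\<^sup>2 * b\<^sup>2)) / (b\<^sup>2 * (1 - a\<^sup>2)\<^sup>2)"
    proof -
      have "b * (a\<^sup>2 - 1) * (b * (1 - a\<^sup>2)) = - (b\<^sup>2 * (1 - a\<^sup>2)\<^sup>2)"
        "(a\<^sup>2 - b\<^sup>2) * (1 - a\<^sup>2 * b\<^sup>2) = - ((b\<^sup>2 - a\<^sup>2) * (1 - a\<^sup>2 * b\<^sup>2))"
        by (simp_all add: algebra_simps power2_eq_square)
      then show ?thesis unfolding times_divide_times_eq by (simp only: minus_divide_left[symmetric] minus_divide_right[symmetric] minus_minus)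
    qed
    also have "(b\<^sup>2 - a\<^sup>2) * (1 - a\<^sup>2 * b\<^sup>2) = b\<^sup>2 * (1 - a\<^sup>2)\<^sup>2 + (2 * b\<^sup>2 - b\<^sup>2 * b\<^sup>2 - 1) * a\<^sup>2"
      by (simp add: algebra_simps power2_eq_square)
    also have "\<dots> / (b\<^sup>2 * (1 - a\<^sup>2)\<^sup>2) = 1 + (2 - b\<^sup>2 - 1 / b\<^sup>2) * inverse ((1 - a\<^sup>2)\<^sup>2) * a\<^sup>2"
    proof -
      have "(x * y + (2 * x - x * x - 1) * w) / (x * y) = 1 + (2 - x - 1 / x) * inverse y * w"
        if "x \<noteq> 0" "y \<noteq> 0" for x y w :: complex
        using that by (simp add: field_simps)
      from this[of "b\<^sup>2" "(1 - a\<^sup>2)\<^sup>2" "a\<^sup>2"] show ?thesis using ab a1 by simp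
    qed
    finally show ?thesis
      unfolding s1 s2 s3 s4 nome_factor_def qm zb x1[OF ii] x2[OF ii] .
  qed
  then have prod: "(\<Prod>m\<in>{- int M..int M} - {0}. sin (of_real pi * (of_int m * \<tau> - z)) / sin (of_real pi * (of_int m * \<tau>)))
      = (\<Prod>m=1..M. nome_factor (unit_exp z) m (unit_exp \<tau>))"
    unfolding prod_symmetric_int_nonzero by (intro prod.cong) auto
  have "exp (of_real pi * \<i> * z) * (sin (of_real pi * z) / of_real pi) = (unit_exp z - 1) / (2 * of_real pi * \<i>)"
  proof -
    have "exp (of_real pi * \<i> * z) * ?e z = unit_exp z" "exp (of_real pi * \<i> * z) * exp (- (\<i> * of_real pi * z)) = 1"
      unfolding unit_exp_def exp_add[symmetric] by (simp_all add: mult_ac)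
    moreover have "e * ((x - y) / (2 * \<i>) / p) = (e * x - e * y) / (2 * p * \<i>)" for e x y p :: complex
      by (simp add: right_diff_distrib[of e] mult_ac del: divide_i)
    ultimately show ?thesis unfolding sin_pi_mult_eq by (simp only:)
  qed
  then show ?thesis unfolding sin_prod_def[OF \<tau>] prod
    by (metis (no_types) mult.assoc)
qed

lemma reduced_sigma_expansion:
  "\<exists>(r0 :: nat \<Rightarrow> nat) (c :: nat \<Rightarrow> int \<Rightarrow> complex).
     mono r0 \<and> (\<lambda>n. real (r0 n) / real n) \<longlonglongrightarrow> 0 \<and>
     (\<forall>\<tau> z. Im \<tau> > 0 \<longrightarrow>
        (\<lambda>n. \<Sum>r | \<bar>r\<bar> \<le> int (r0 n). c n r * unit_exp \<tau> ^ n * unit_exp z powi r) sums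
          (exp (of_real pi * \<i> * z) * reduced_sigma \<tau> z))"
proof -
  obtain c where c: "\<And>M. laurent_supported (\<lambda>\<zeta>. fps_const (\<zeta> - 1) * (\<Prod>m=1..M. nome_factor_fps \<zeta> m))
      (- int M) (int M + 1) (c M)"
    using laurent_supported_nome_prod by metis
  \<comment> \<open>For r \<noteq> 0 the constraint r(r - 1) \<le> 2n implies (|r| - 1)^2 \<le> 2n,
    hence |r| \<le> sqrt(2n) + 1. The summand 1 also covers n = 0, where \<zeta> - 1 already
    contains the exponent 1.\<close>
  define r0 where "r0 = (\<lambda>n::nat. nat \<lfloor>sqrt (2 * real n)\<rfloor> + 1)"
  have "mono r0" unfolding r0_def by (intro monoI add_right_mono nat_mono floor_mono) simp
  moreover have "(\<lambda>n. real (r0 n) / real n) \<longlonglongrightarrow> 0"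
  proof (rule tendsto_sandwich)
    show "\<forall>\<^sub>F n in sequentially. 0 \<le> real (r0 n) / real n" by simp
    show "\<forall>\<^sub>F n in sequentially. real (r0 n) / real n \<le> (sqrt (2 * real n) + 1) / real n"
      unfolding r0_def by (intro always_eventually allI divide_right_mono) auto
    show "(\<lambda>n. (sqrt (2 * real n) + 1) / real n) \<longlonglongrightarrow> 0" by real_asymp
  qed simp
  \<comment> \<open>The diagonal \<open>c n n r\<close> takes the coefficient of q^n from the
    product of the first n factors, where it has become stationary.\<close>
  moreover have "(\<lambda>n. \<Sum>r | \<bar>r\<bar> \<le> int (r0 n). c n n r / (2 * of_real pi * \<i>) * unit_exp \<tau> ^ n * unit_exp z powi r) sums
          (exp (of_real pi * \<i> * z) * reduced_sigma \<tau> z)" if \<tau>: "Im \<tau> > 0" for \<tau> z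
  proof -
    let ?\<zeta> = "unit_exp z" and ?q = "unit_exp \<tau>"
    let ?k = "2 * of_real pi * \<i> :: complex"
    have \<zeta>: "?\<zeta> \<noteq> 0" by (simp add: unit_exp_def)
    have q: "norm ?q < 1" using \<tau> by (simp add: unit_exp_def)
    have coeff: "(?\<zeta> - 1) * ((\<Prod>m=1..n. nome_factor_fps ?\<zeta> m) $ n) = (\<Sum>r | \<bar>r\<bar> \<le> int (r0 n). c n n r * ?\<zeta> powi r)" for n
    proof -
      have "(?\<zeta> - 1) * ((\<Prod>m=1..n. nome_factor_fps ?\<zeta> m) $ n) = (\<Sum>r\<in>{- int n..int n + 1}. c n n r * ?\<zeta> powi r)"
        using c[of n] \<zeta> unfolding laurent_supported_def by simp
      \<comment> \<open>In general neither index range contains the other: for small n the range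
        given by \<open>r0\<close> can be the wider one, for large n the window of the product is.
        Terms outside the intersection vanish by the window or by the parabola.\<close>
      also have "\<dots> = (\<Sum>r | \<bar>r\<bar> \<le> int (r0 n). c n n r * ?\<zeta> powi r)"
      proof (rule sum.mono_neutral_cong)
        have "{r. \<bar>r\<bar> \<le> int (r0 n)} = {- int (r0 n)..int (r0 n)}" by auto
        then show "finite {r. \<bar>r\<bar> \<le> int (r0 n)}" by simp
        show "c n n r * ?\<zeta> powi r = 0" if "r \<in> {r. \<bar>r\<bar> \<le> int (r0 n)} - {- int n..int n + 1}" for r
          using c[of n] that unfolding laurent_supported_def by fastforce
        show "c n n r * ?\<zeta> powi r = 0" if r: "r \<in> {- int n..int n + 1} - {r. \<bar>r\<bar> \<le> int (r0 n)}" for r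
        proof (rule ccontr)
          assume "c n n r * ?\<zeta> powi r \<noteq> 0"
          then have "r * (r - 1) \<le> 2 * int n" using c[of n] unfolding laurent_supported_def by force
          moreover have "r \<noteq> 0" using r by auto
          then have "(\<bar>r\<bar> - 1)\<^sup>2 \<le> r * (r - 1)"
            by (cases "r > 0") (auto simp: power2_eq_square algebra_simps)
          ultimately have "(\<bar>r\<bar> - 1)\<^sup>2 \<le> 2 * int n" by linarith
          then have "real_of_int ((\<bar>r\<bar> - 1)\<^sup>2) \<le> real_of_int (2 * int n)" by (simp only: of_int_le_iff)
          then have "real_of_int (\<bar>r\<bar> - 1) \<le> sqrt (2 * real n)" by (intro real_le_rsqrt) simp
          then have "\<bar>r\<bar> - 1 \<le> \<lfloor>sqrt (2 * real n)\<rfloor>" by (simp only: le_floor_iff)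
          with r show False by (simp add: r0_def)
        qed
      qed auto
      finally show ?thesis .
    qed
    have "(\<lambda>M. exp (of_real pi * \<i> * z) * sin_prod \<tau> z M) \<longlonglongrightarrow> exp (of_real pi * \<i> * z) * reduced_sigma \<tau> z"
      by (intro tendsto_intros tendsto_sin_prod \<tau>)
    note lim = this[unfolded exp_mult_sin_prod[OF \<tau>]]
    obtain F where "uniform_limit (cball 0 (norm ?q)) (\<lambda>M q. \<Prod>m=1..M. nome_factor ?\<zeta> m q) F sequentially"
      using uniform_limit_nome_prod[of "norm ?q" ?\<zeta>] q by auto
    then have l: "(\<lambda>M. \<Prod>m=1..M. nome_factor ?\<zeta> m ?q) \<longlonglongrightarrow> F ?q"
      by (rule tendsto_uniform_limitI) simp
    have eq: "exp (of_real pi * \<i> * z) * reduced_sigma \<tau> z = (?\<zeta> - 1) / ?k * F ?q"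
      by (rule LIMSEQ_unique[OF lim tendsto_mult[OF tendsto_const l]])
    have "(\<lambda>n. (?\<zeta> - 1) / ?k * ((\<Prod>m=1..n. nome_factor_fps ?\<zeta> m) $ n * ?q ^ n)) sums ((?\<zeta> - 1) / ?k * F ?q)"
      by (intro sums_mult nome_prod_sums q l)
    moreover have "(?\<zeta> - 1) / ?k * ((\<Prod>m=1..n. nome_factor_fps ?\<zeta> m) $ n * ?q ^ n) =
        (\<Sum>r | \<bar>r\<bar> \<le> int (r0 n). c n n r / ?k * ?q ^ n * ?\<zeta> powi r)" for n
    proof -
      have "(?\<zeta> - 1) / ?k * ((\<Prod>m=1..n. nome_factor_fps ?\<zeta> m) $ n * ?q ^ n) =
          (?q ^ n / ?k) * ((?\<zeta> - 1) * ((\<Prod>m=1..n. nome_factor_fps ?\<zeta> m) $ n))" by simp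
      also have "\<dots> = (\<Sum>r | \<bar>r\<bar> \<le> int (r0 n). c n n r / ?k * ?q ^ n * ?\<zeta> powi r)"
        unfolding coeff sum_distrib_left by (intro sum.cong) auto
      finally show ?thesis .
    qed
    ultimately show ?thesis unfolding eq by simp
  qed
  ultimately show ?thesis by (intro exI[of _ r0] exI[of _ "\<lambda>n r. c n n r / (2 * of_real pi * \<i>)"]) blast
qed

theorem theorem3p4:
  "(\<lambda>\<tau> z. weierstrass_sigma z (period_lattice \<tau> 1)) \<in> jacobi_forms (-1) SL2Z"
proof -
  let ?\<sigma> = "\<lambda>\<tau> z. weierstrass_sigma z (period_lattice \<tau> 1)"
  \<comment> \<open>At the real point 1 the term with Im z / Im \<tau> vanishes, so \<eta>(1) = G2
    and 1/\<rho> contains precisely the Gaussian factor that defines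
    \<open>reduced_sigma\<close>.\<close>
  have "rho \<tau> z powi (-1) * ?\<sigma> \<tau> z = exp (of_real pi * \<i> * z) * reduced_sigma \<tau> z" if "Im \<tau> > 0" for \<tau> z
  proof -
    have "rho \<tau> z powi (-1) = exp (of_real pi * \<i> * z) * exp (- (z\<^sup>2 / 2 * eisenstein2 \<tau>))"
      unfolding rho_def power_int_minus power_int_1_right exp_minus[symmetric] exp_add[symmetric]
      by (rule arg_cong[where f = exp]) (simp add: eta_ext_eq[OF that])
    then show ?thesis by (simp add: reduced_sigma_def)
  qed
  \<comment> \<open>Modular invariance replaces the slashed function by \<sigma> itself in the
    expansion condition, so one pair \<open>r0\<close>, \<open>c\<close> serves every
    matrix.\<close>
  with reduced_sigma_expansion show ?thesis
    unfolding jacobi_forms_def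
    by (simp add: holomorphic2_on_weierstrass_sigma[unfolded upper_half_plane_def] slash_mod_weierstrass_sigma
        slash_ell_weierstrass_sigma[simplified] upper_half_plane_def)
qed

end
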